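(* Let $(F,f_1,f_2,G,g_1,g_2)$ be a regular solution of $$F\Big(\frac{x+y}{2}\Big)+f_1(x)+f_2(y)=G(g_1(x)+g_2(y)),\qquad x,y\in I, \tag{E}$$ such that condition (B.2.1) (defined in the context) holds. Then there exist $A,B,C,D,T\in\mathbb{R}$ with $AD\neq0$, $\alpha,\beta,\beta_1,\beta_2\in\mathbb{R}$ with $\alpha\neq0$ and $\beta_1+\beta_2\in\mathbb{Z}\pi+\beta$, and $\lambda,\lambda_1,\lambda_2,\mu_1,\mu_2\in\mathbb{R}$ such that $F$ is of the form $$F(x)=2A\ln|\sin(2\alpha x+\beta)|+2Bx+\lambda,\qquad x\in I,$$ and, with $\tau:=\big|\frac{T-1}{T+1}\big|^{1/2}$ (when $T\ne\pm1$), $T^*:=|T^2-1|^{-1/2}$ (when $T\neq\pm1$), $\mu:=\mu_1+\mu_2$ and $\Lambda:=\lambda+\lambda_1+\lambda_2$, for $k=1,2$ and for all $x\in I$ and $u\in g_1(I)+g_2(I)$, we have either (T.1) $T^2<1$ and $$f_k(x)=-A\ln|\cos(2\alpha x+2\beta_k)+T|-Bx+C\ln\Big|\frac{\tau\tan(\alpha x+\beta_k)-1}{\tau\tan(\alpha x+\beta_k)+1}\Big|+\lambda_k,$$ $$g_k(x)=D\ln\Big|\frac{\tau\tan(\alpha x+\beta_k)-1}{\tau\tan(\alpha x+\beta_k)+1}\Big|+\mu_k,\qquad G(u)=2A\ln\Big|T^*\sinh\Big(\frac{u-\mu}{2D}\Big)\Big|+C\frac{u-\mu}{D}+\Lambda,$$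 or (T.2) $T^2=1$ and $$f_k(x)=-A\ln|\cos(2\alpha x+2\beta_k)+T|-Bx+C\tan^T(\alpha x+\beta_k)+\lambda_k,$$ $$g_k(x)=D\tan^T(\alpha x+\beta_k)+\mu_k,\qquad G(u)=2A\ln\Big|\frac{u-\mu}{2D}\Big|+C\frac{u-\mu}{D}+\Lambda,$$ or (T.3) $T^2>1$ and $$f_k(x)=-A\ln|\cos(2\alpha x+2\beta_k)+T|-Bx+C\arctan(\tau\tan(\alpha x+\beta_k))+\lambda_k,$$ $$g_k(x)=D\arctan(\tau\tan(\alpha x+\beta_k))+\mu_k,\qquad G(u)=2A\ln\Big|T^*\sin\Big(\frac{u-\mu}{D}\Big)\Big|+C\frac{u-\mu}{D}+\Lambda.$$ Conversely, in each of the possibilities (T.1), (T.2) and (T.3), with $F(x)=2A\ln|\sin(2\alpha x+\beta)|+2Bx+\lambda$ for $x\in I$ and with constants as listed in this statement, we obtain a regular solution of (E).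
   Context: $I\subseteq\mathbb{R}$ is a nonempty open interval; $F,f_1,f_2,g_1,g_2:I\to\mathbb{R}$ and $G:g_1(I)+g_2(I)\to\mathbb{R}$, where $X+Y=\{x+y\mid x\in X,\ y\in Y\}$. The tuple $(F,f_1,f_2,G,g_1,g_2)$ is called regular if all six functions are continuously differentiable on their domains and $0\notin g_1'(I)\cup g_2'(I)$. The expression $\tan^T$ means $\tan$ if $T=1$ and $1/\tan$ if $T=-1$. For a regular solution put, on $I$ and for $k=1,2$, $$\varphi:=\tfrac12F',\qquad \psi_k:=\frac1{g_1'}+(-1)^k\frac1{g_2'},\qquad \Psi_k:=-\frac{f_1'}{g_1'}+(-1)^{k-1}\frac{f_2'}{g_2'}.$$ A function on $I$ is nowhere constant if it is neither constant on $I$ nor constant on some subinterval of $I$ of positive length different from $I$. Condition (4.2): there exist $a,b,c,d,\gamma\in\mathbb{R}$ with $ad\neq bc$ such that, with $\kappa:=\sqrt{|\gamma|}$, for all $x\in I$ $$\varphi(x)=\frac{cS(x)+dC_0(x)}{aS(x)+bC_0(x)},\qquad \psi_1(x)=aS(x)+bC_0(x)\neq0,$$ where $(S(x),C_0(x))$ is $(\sin\kappa x,\cos\kappa x)$ if $\gamma<0$, $(x,1)$ if $\gamma=0$, and $(\sinh\kappa x,\cosh\kappa x)$ if $\gamma>0$. Condition (5.2): there exist $a^*,b^*,c^*,d^*,\gamma^*\in\mathbb{R}$ with $a^*d^*\neq b^*c^*$ and $\lambda^*,\mu^*\in\mathbb{R}$ such that, with $\kappa^*:=\sqrt{|\gamma^*|}$,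 for all $x\in I$ $$\varphi(x)=\frac{c^*S(x)+d^*C_0(x)}{a^*S(x)+b^*C_0(x)},\quad \psi_2(x)=a^*P(x)+b^*Q(x)+\lambda^*,\quad \Psi_2(x)=c^*P(x)+d^*Q(x)+\mu^*,$$ where $(S,C_0)$ is as in (4.2) with $\gamma^*,\kappa^*$ in place of $\gamma,\kappa$, and $(P(x),Q(x))$ is $(-\cos\kappa^*x,\sin\kappa^*x)$ if $\gamma^*<0$, $(\frac12x^2,x)$ if $\gamma^*=0$, and $(\cosh\kappa^*x,\sinh\kappa^*x)$ if $\gamma^*>0$. Condition (B.2.1): $\varphi$ is nowhere constant on $I$, at least one of (4.2) and (5.2) holds, and $\varphi$ is a trigonometric fraction on $I$, that is, $\varphi(x)=\frac{c\sin(\kappa x)+d\cos(\kappa x)}{a\sin(\kappa x)+b\cos(\kappa x)}$ for all $x\in I$ with some $a,b,c,d,\kappa\in\mathbb{R}$, $ad\neq bc$, $\kappa>0$.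
   Formalization: In (T.1), sinh is used only if (cos(2αx+2β₁)+T)(cos(2αx+2β₂)+T)>0; if this product is <0, cosh replaces sinh. In (T.3), arctan(τ tan(·)) means its continuous branch. At poles of tan, the ln term in (T.1) and 1/tan in (T.2) take their limit value 0. *)

theory Defs
  imports "HOL-Analysis.Analysis"
begin

section \<open>Regular solutions\<close>

(* The pairs (f_1, f_2) and (g_1, g_2) are families f, g of which only the indices 1, 2 are used.
   C1_differentiable_on uses two-sided derivatives.  For G this is the right notion, because
   g_1(I) + g_2(I) is open: each g_k is continuously differentiable without critical points. *)

definition regular ::
    "real set \<Rightarrow> (real \<Rightarrow> real) \<Rightarrow> (nat \<Rightarrow> real \<Rightarrow> real) \<Rightarrow> (real \<Rightarrow> real) \<Rightarrow> (nat \<Rightarrow> real \<Rightarrow> real) \<Rightarrow> bool" where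
  "regular I F f G g \<longleftrightarrow>
     F C1_differentiable_on I \<and>
     (\<forall>k\<in>{1, 2}. f k C1_differentiable_on I \<and> g k C1_differentiable_on I) \<and>
     G C1_differentiable_on (g 1 ` I + g 2 ` I) \<and>
     0 \<notin> deriv (g 1) ` I \<union> deriv (g 2) ` I"

definition solves_E ::
    "real set \<Rightarrow> (real \<Rightarrow> real) \<Rightarrow> (nat \<Rightarrow> real \<Rightarrow> real) \<Rightarrow> (real \<Rightarrow> real) \<Rightarrow> (nat \<Rightarrow> real \<Rightarrow> real) \<Rightarrow> bool" where
  "solves_E I F f G g \<longleftrightarrow>
     (\<forall>x\<in>I. \<forall>y\<in>I. F ((x + y) / 2) + f 1 x + f 2 y = G (g 1 x + g 2 y))"

definition regular_solution ::
    "real set \<Rightarrow> (real \<Rightarrow> real) \<Rightarrow> (nat \<Rightarrow> real \<Rightarrow> real) \<Rightarrow> (real \<Rightarrow> real) \<Rightarrow> (nat \<Rightarrow> real \<Rightarrow> real) \<Rightarrow> bool" where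
  "regular_solution I F f G g \<longleftrightarrow> regular I F f G g \<and> solves_E I F f G g"

section \<open>The hypothesis on \<open>\<phi>\<close>, \<open>\<psi>\<close> and \<open>\<Psi>\<close>\<close>

definition \<phi> :: "(real \<Rightarrow> real) \<Rightarrow> real \<Rightarrow> real" where
  "\<phi> F x = 1/2 * deriv F x"

definition \<psi> :: "(nat \<Rightarrow> real \<Rightarrow> real) \<Rightarrow> nat \<Rightarrow> real \<Rightarrow> real" where
  "\<psi> g k x = 1 / deriv (g 1) x + (-1) ^ k * (1 / deriv (g 2) x)"

definition \<Psi> :: "(nat \<Rightarrow> real \<Rightarrow> real) \<Rightarrow> (nat \<Rightarrow> real \<Rightarrow> real) \<Rightarrow> nat \<Rightarrow> real \<Rightarrow> real" where
  "\<Psi> f g k x = - (deriv (f 1) x / deriv (g 1) x) + (-1) ^ (k - 1) * (deriv (f 2) x / deriv (g 2) x)"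

definition nowhere_constant_on :: "(real \<Rightarrow> real) \<Rightarrow> real set \<Rightarrow> bool" where
  "nowhere_constant_on h I \<longleftrightarrow>
     \<not> h constant_on I \<and>
     \<not> (\<exists>J. J \<subseteq> I \<and> J \<noteq> I \<and> is_interval J \<and> (\<exists>s\<in>J. \<exists>t\<in>J. s < t) \<and> h constant_on J)"

definition S_fun :: "real \<Rightarrow> real \<Rightarrow> real" where
  "S_fun \<gamma> x = (let \<kappa> = sqrt \<bar>\<gamma>\<bar> in
     if \<gamma> < 0 then sin (\<kappa> * x) else if \<gamma> = 0 then x else sinh (\<kappa> * x))"

definition C_fun :: "real \<Rightarrow> real \<Rightarrow> real" where
  "C_fun \<gamma> x = (let \<kappa> = sqrt \<bar>\<gamma>\<bar> in
     if \<gamma> < 0 then cos (\<kappa> * x) else if \<gamma> = 0 then 1 else cosh (\<kappa> * x))"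

definition P_fun :: "real \<Rightarrow> real \<Rightarrow> real" where
  "P_fun \<gamma> x = (let \<kappa> = sqrt \<bar>\<gamma>\<bar> in
     if \<gamma> < 0 then - cos (\<kappa> * x) else if \<gamma> = 0 then 1/2 * x\<^sup>2 else cosh (\<kappa> * x))"

definition Q_fun :: "real \<Rightarrow> real \<Rightarrow> real" where
  "Q_fun \<gamma> x = (let \<kappa> = sqrt \<bar>\<gamma>\<bar> in
     if \<gamma> < 0 then sin (\<kappa> * x) else if \<gamma> = 0 then x else sinh (\<kappa> * x))"

definition psi1_condition ::
    "real set \<Rightarrow> (real \<Rightarrow> real) \<Rightarrow> (nat \<Rightarrow> real \<Rightarrow> real) \<Rightarrow> bool" where
  "psi1_condition I F g \<longleftrightarrow>
     (\<exists>a b c d \<gamma>. a * d \<noteq> b * c \<and>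
        (\<forall>x\<in>I. \<phi> F x = (c * S_fun \<gamma> x + d * C_fun \<gamma> x) / (a * S_fun \<gamma> x + b * C_fun \<gamma> x) \<and>
               \<psi> g 1 x = a * S_fun \<gamma> x + b * C_fun \<gamma> x \<and>
               a * S_fun \<gamma> x + b * C_fun \<gamma> x \<noteq> 0))"

(* Here and in trig_fraction_on, the nonvanishing of the denominator says that the
   fraction is defined (division by zero is 0 in HOL). *)
definition psi2_condition ::
    "real set \<Rightarrow> (real \<Rightarrow> real) \<Rightarrow> (nat \<Rightarrow> real \<Rightarrow> real) \<Rightarrow> (nat \<Rightarrow> real \<Rightarrow> real) \<Rightarrow> bool" where
  "psi2_condition I F f g \<longleftrightarrow>
     (\<exists>a b c d \<gamma> l m. a * d \<noteq> b * c \<and>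
        (\<forall>x\<in>I. a * S_fun \<gamma> x + b * C_fun \<gamma> x \<noteq> 0 \<and>
               \<phi> F x = (c * S_fun \<gamma> x + d * C_fun \<gamma> x) / (a * S_fun \<gamma> x + b * C_fun \<gamma> x) \<and>
               \<psi> g 2 x = a * P_fun \<gamma> x + b * Q_fun \<gamma> x + l \<and>
               \<Psi> f g 2 x = c * P_fun \<gamma> x + d * Q_fun \<gamma> x + m))"

definition trig_fraction_on :: "(real \<Rightarrow> real) \<Rightarrow> real set \<Rightarrow> bool" where
  "trig_fraction_on h I \<longleftrightarrow>
     (\<exists>a b c d \<kappa>. a * d \<noteq> b * c \<and> \<kappa> > 0 \<and>
        (\<forall>x\<in>I. a * sin (\<kappa> * x) + b * cos (\<kappa> * x) \<noteq> 0 \<and>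
               h x = (c * sin (\<kappa> * x) + d * cos (\<kappa> * x)) / (a * sin (\<kappa> * x) + b * cos (\<kappa> * x))))"

definition trig_condition ::
    "real set \<Rightarrow> (real \<Rightarrow> real) \<Rightarrow> (nat \<Rightarrow> real \<Rightarrow> real) \<Rightarrow> (nat \<Rightarrow> real \<Rightarrow> real) \<Rightarrow> bool" where
  "trig_condition I F f g \<longleftrightarrow>
     nowhere_constant_on (\<phi> F) I \<and>
     (psi1_condition I F g \<or> psi2_condition I F f g) \<and>
     trig_fraction_on (\<phi> F) I"

section \<open>The solution families\<close>

definition tau :: "real \<Rightarrow> real" where
  "tau T = sqrt \<bar>(T - 1) / (T + 1)\<bar>"

definition T_star :: "real \<Rightarrow> real" where
  "T_star T = 1 / sqrt \<bar>T\<^sup>2 - 1\<bar>"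

(* At a pole of tan the quotient tends to 1, so the continuous extension is 0.  The HOL
   convention tan x = 0 at a pole yields ln 1 = 0 as well: no case distinction is needed. *)
definition ln_tan :: "real \<Rightarrow> real \<Rightarrow> real" where
  "ln_tan \<tau> x = ln \<bar>(\<tau> * tan x - 1) / (\<tau> * tan x + 1)\<bar>"

(* For T = -1 this is the cotangent, with value 0 at the poles of tan (HOL convention). *)
definition tan_pow :: "real \<Rightarrow> real \<Rightarrow> real" where
  "tan_pow T x = (if T = 1 then tan x else 1 / tan x)"

(* The continuous branch of arctan (\<tau> tan x) on the real line, for \<tau> > 0.  It is the principal
   value for |x| < pi/2 and differs from it by a constant on every interval without a pole of
   tan, where the constant can be absorbed in l k and \<mu> k below.  The principal value itself
   would make f k and g k jump wherever \<alpha> x + \<beta> k runs through a pole of tan in I, which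
   does occur for regular solutions. *)
definition arctan_tan :: "real \<Rightarrow> real \<Rightarrow> real" where
  "arctan_tan \<tau> x =
     (if cos x = 0 then x else arctan (\<tau> * tan x) + pi * of_int (round (x / pi)))"

definition F_form ::
    "real set \<Rightarrow> (real \<Rightarrow> real) \<Rightarrow> real \<Rightarrow> real \<Rightarrow> real \<Rightarrow> real \<Rightarrow> real \<Rightarrow> bool" where
  "F_form I F A B \<alpha> \<beta>\<^sub>0 l\<^sub>0 \<longleftrightarrow>
     (\<forall>x\<in>I. sin (2 * \<alpha> * x + \<beta>\<^sub>0) \<noteq> 0 \<and>
            F x = 2 * A * ln \<bar>sin (2 * \<alpha> * x + \<beta>\<^sub>0)\<bar> + 2 * B * x + l\<^sub>0)"

(* f_k and g_k are built in the same way from a function h, which is different in the three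
   cases.  cos (2 \<theta>) + T \<noteq> 0 expresses that the logarithm in f_k is defined; for \<theta> off the poles
   of tan it is also what makes the respective h defined at \<theta>. *)
definition fg_form ::
    "real set \<Rightarrow> (real \<Rightarrow> real) \<Rightarrow> (nat \<Rightarrow> real \<Rightarrow> real) \<Rightarrow> (nat \<Rightarrow> real \<Rightarrow> real) \<Rightarrow>
     real \<Rightarrow> real \<Rightarrow> real \<Rightarrow> real \<Rightarrow> real \<Rightarrow> real \<Rightarrow> (nat \<Rightarrow> real) \<Rightarrow> (nat \<Rightarrow> real) \<Rightarrow> (nat \<Rightarrow> real) \<Rightarrow> bool" where
  "fg_form I h f g A B C D T \<alpha> \<beta> l \<mu> \<longleftrightarrow>
     (\<forall>k\<in>{1, 2}. \<forall>x\<in>I.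
        cos (2 * \<alpha> * x + 2 * \<beta> k) + T \<noteq> 0 \<and>
        f k x = - A * ln \<bar>cos (2 * \<alpha> * x + 2 * \<beta> k) + T\<bar> - B * x + C * h (\<alpha> * x + \<beta> k) + l k \<and>
        g k x = D * h (\<alpha> * x + \<beta> k) + \<mu> k)"

(* Similarly, G is 2 A ln |w| + C (u - \<mu>)/D + \<Lambda> with w different in the three cases. *)
definition G_form ::
    "real set \<Rightarrow> (real \<Rightarrow> real) \<Rightarrow> (real \<Rightarrow> real) \<Rightarrow> real \<Rightarrow> real \<Rightarrow> real \<Rightarrow> real \<Rightarrow> real \<Rightarrow> bool" where
  "G_form U w G A C D m \<Lambda> \<longleftrightarrow>
     (\<forall>u\<in>U. w (u - m) \<noteq> 0 \<and> G u = 2 * A * ln \<bar>w (u - m)\<bar> + C * ((u - m) / D) + \<Lambda>)"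

(* T^2 < 1: whether sinh or cosh occurs depends on the sign of
   (cos (2 \<alpha> x + 2 \<beta>_1) + T) (cos (2 \<alpha> x + 2 \<beta>_2) + T), which is the sign of g_1' g_2'.
   Put \<tau> = tau T, R_k = (\<tau> tan \<theta>_k - 1)/(\<tau> tan \<theta>_k + 1) and e^v = |R_1 R_2|.  Then
   sin (\<theta>_1 + \<theta>_2)^2 / ((cos (2 \<theta>_1) + T) (cos (2 \<theta>_2) + T)) is a constant times
   (R_1 R_2 - 1)^2 / (4 R_1 R_2), which is sinh (v/2)^2 if R_1 R_2 > 0 and
   - cosh (v/2)^2 if R_1 R_2 < 0.  The second case does occur: on (-pi/8, pi/8),
   2 ln (cos (x + y)) - ln (sin (pi/4 - 2 x)) - ln (sin (pi/4 + 2 y)) = 2 ln (cosh (u/2))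
   with u = ln (tan (pi/8 - x)) + ln (tan (pi/8 + y)). *)
definition T1_sinh ::
    "real set \<Rightarrow> (nat \<Rightarrow> real \<Rightarrow> real) \<Rightarrow> (real \<Rightarrow> real) \<Rightarrow> (nat \<Rightarrow> real \<Rightarrow> real) \<Rightarrow>
     real \<Rightarrow> real \<Rightarrow> real \<Rightarrow> real \<Rightarrow> real \<Rightarrow> real \<Rightarrow> (nat \<Rightarrow> real) \<Rightarrow> real \<Rightarrow> (nat \<Rightarrow> real) \<Rightarrow> (nat \<Rightarrow> real) \<Rightarrow> bool" where
  "T1_sinh I f G g A B C D T \<alpha> \<beta> l\<^sub>0 l \<mu> \<longleftrightarrow>
     T\<^sup>2 < 1 \<and>
     fg_form I (ln_tan (tau T)) f g A B C D T \<alpha> \<beta> l \<mu> \<and>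
     (\<forall>x\<in>I. (cos (2 * \<alpha> * x + 2 * \<beta> 1) + T) * (cos (2 * \<alpha> * x + 2 * \<beta> 2) + T) > 0) \<and>
     G_form (g 1 ` I + g 2 ` I) (\<lambda>v. T_star T * sinh (v / (2 * D))) G A C D
       (\<mu> 1 + \<mu> 2) (l\<^sub>0 + l 1 + l 2)"

definition T1_cosh ::
    "real set \<Rightarrow> (nat \<Rightarrow> real \<Rightarrow> real) \<Rightarrow> (real \<Rightarrow> real) \<Rightarrow> (nat \<Rightarrow> real \<Rightarrow> real) \<Rightarrow>
     real \<Rightarrow> real \<Rightarrow> real \<Rightarrow> real \<Rightarrow> real \<Rightarrow> real \<Rightarrow> (nat \<Rightarrow> real) \<Rightarrow> real \<Rightarrow> (nat \<Rightarrow> real) \<Rightarrow> (nat \<Rightarrow> real) \<Rightarrow> bool" where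
  "T1_cosh I f G g A B C D T \<alpha> \<beta> l\<^sub>0 l \<mu> \<longleftrightarrow>
     T\<^sup>2 < 1 \<and>
     fg_form I (ln_tan (tau T)) f g A B C D T \<alpha> \<beta> l \<mu> \<and>
     (\<forall>x\<in>I. (cos (2 * \<alpha> * x + 2 * \<beta> 1) + T) * (cos (2 * \<alpha> * x + 2 * \<beta> 2) + T) < 0) \<and>
     G_form (g 1 ` I + g 2 ` I) (\<lambda>v. T_star T * cosh (v / (2 * D))) G A C D
       (\<mu> 1 + \<mu> 2) (l\<^sub>0 + l 1 + l 2)"

definition T2 ::
    "real set \<Rightarrow> (nat \<Rightarrow> real \<Rightarrow> real) \<Rightarrow> (real \<Rightarrow> real) \<Rightarrow> (nat \<Rightarrow> real \<Rightarrow> real) \<Rightarrow>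
     real \<Rightarrow> real \<Rightarrow> real \<Rightarrow> real \<Rightarrow> real \<Rightarrow> real \<Rightarrow> (nat \<Rightarrow> real) \<Rightarrow> real \<Rightarrow> (nat \<Rightarrow> real) \<Rightarrow> (nat \<Rightarrow> real) \<Rightarrow> bool" where
  "T2 I f G g A B C D T \<alpha> \<beta> l\<^sub>0 l \<mu> \<longleftrightarrow>
     T\<^sup>2 = 1 \<and>
     fg_form I (tan_pow T) f g A B C D T \<alpha> \<beta> l \<mu> \<and>
     G_form (g 1 ` I + g 2 ` I) (\<lambda>v. v / (2 * D)) G A C D
       (\<mu> 1 + \<mu> 2) (l\<^sub>0 + l 1 + l 2)"

definition T3 ::
    "real set \<Rightarrow> (nat \<Rightarrow> real \<Rightarrow> real) \<Rightarrow> (real \<Rightarrow> real) \<Rightarrow> (nat \<Rightarrow> real \<Rightarrow> real) \<Rightarrow>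
     real \<Rightarrow> real \<Rightarrow> real \<Rightarrow> real \<Rightarrow> real \<Rightarrow> real \<Rightarrow> (nat \<Rightarrow> real) \<Rightarrow> real \<Rightarrow> (nat \<Rightarrow> real) \<Rightarrow> (nat \<Rightarrow> real) \<Rightarrow> bool" where
  "T3 I f G g A B C D T \<alpha> \<beta> l\<^sub>0 l \<mu> \<longleftrightarrow>
     T\<^sup>2 > 1 \<and>
     fg_form I (arctan_tan (tau T)) f g A B C D T \<alpha> \<beta> l \<mu> \<and>
     G_form (g 1 ` I + g 2 ` I) (\<lambda>v. T_star T * sin (v / D)) G A C D
       (\<mu> 1 + \<mu> 2) (l\<^sub>0 + l 1 + l 2)"

definition solution_family ::
    "real set \<Rightarrow> (real \<Rightarrow> real) \<Rightarrow> (nat \<Rightarrow> real \<Rightarrow> real) \<Rightarrow> (real \<Rightarrow> real) \<Rightarrow> (nat \<Rightarrow> real \<Rightarrow> real) \<Rightarrow>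
     real \<Rightarrow> real \<Rightarrow> real \<Rightarrow> real \<Rightarrow> real \<Rightarrow> real \<Rightarrow> real \<Rightarrow> (nat \<Rightarrow> real) \<Rightarrow>
     real \<Rightarrow> (nat \<Rightarrow> real) \<Rightarrow> (nat \<Rightarrow> real) \<Rightarrow> bool" where
  "solution_family I F f G g A B C D T \<alpha> \<beta>\<^sub>0 \<beta> l\<^sub>0 l \<mu> \<longleftrightarrow>
     A * D \<noteq> 0 \<and> \<alpha> \<noteq> 0 \<and> (\<exists>n::int. \<beta> 1 + \<beta> 2 = of_int n * pi + \<beta>\<^sub>0) \<and>
     F_form I F A B \<alpha> \<beta>\<^sub>0 l\<^sub>0 \<and>
     (T1_sinh I f G g A B C D T \<alpha> \<beta> l\<^sub>0 l \<mu> \<or>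
      T1_cosh I f G g A B C D T \<alpha> \<beta> l\<^sub>0 l \<mu> \<or>
      T2 I f G g A B C D T \<alpha> \<beta> l\<^sub>0 l \<mu> \<or>
      T3 I f G g A B C D T \<alpha> \<beta> l\<^sub>0 l \<mu>)"

end

theory Submission
  imports Defs
begin

text \<open>Let \<open>p\<^sub>k = 1 / g\<^sub>k'\<close> and \<open>q\<^sub>k = f\<^sub>k' / g\<^sub>k'\<close>. Differentiating the equation in \<open>x\<close> and in \<open>y\<close> and eliminating
  \<open>G'\<close> gives \<open>\<phi> ((x + y) / 2) * (p\<^sub>1 x - p\<^sub>2 y) = q\<^sub>2 y - q\<^sub>1 x\<close> (\<open>regular_solution_functional_equation\<close>).
  A trigonometric fraction has the form \<open>\<phi> x = B + A\<^sub>0 * cot (2 * \<alpha> * x + \<delta>)\<close> with \<open>A\<^sub>0 \<noteq> 0\<close>. With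
  \<open>r\<^sub>k = (q\<^sub>k + B * p\<^sub>k) / A\<^sub>0\<close> and \<open>\<theta> = \<alpha> * x + (\<alpha> * y + \<delta>)\<close> the equation becomes
  \<open>cos \<theta> * p\<^sub>1 x + sin \<theta> * r\<^sub>1 x = cos \<theta> * p\<^sub>2 y + sin \<theta> * r\<^sub>2 y\<close>. By the addition theorems both sides are
  bilinear in \<open>(cos, sin)\<close> of the two parts of \<open>\<theta>\<close> (\<open>trig_separation\<close>), which leaves only
  \<open>p\<^sub>k = E + H * cos (2 * \<alpha> * x + 2 * \<beta>\<^sub>k)\<close> and \<open>r\<^sub>k = H * sin (2 * \<alpha> * x + 2 * \<beta>\<^sub>k) - M\<close> with
  \<open>\<beta>\<^sub>1 + \<beta>\<^sub>2 = \<delta>\<close> (\<open>regular_solution_structure\<close>). The conditions on \<open>\<psi>\<^sub>1\<close> and \<open>\<psi>\<^sub>2\<close> exclude \<open>H = 0\<close>,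
  that is, affine \<open>g\<^sub>k\<close> with equal slopes.

  With \<open>T = E / H\<close> it remains to integrate \<open>g\<^sub>k' = 1 / (H * (cos (2 * \<alpha> * x + 2 * \<beta>\<^sub>k) + T))\<close>. The sign of
  \<open>T\<^sup>2 - 1\<close> decides which elementary function \<open>h\<close> is the primitive, and each of them has an addition
  law: \<open>(sin (\<theta> + \<eta>))\<^sup>2 / \<bar>(cos (2 * \<theta>) + T) * (cos (2 * \<eta>) + T)\<bar>\<close> is the square of a function \<open>w\<close> of
  \<open>h \<theta> + h \<eta>\<close>. Taking logarithms, \<open>F ((x + y) / 2) + f\<^sub>1 x + f\<^sub>2 y\<close> is the asserted expression in
  \<open>g\<^sub>1 x + g\<^sub>2 y\<close> (\<open>family_satisfies_E\<close>). This determines \<open>G\<close> and, read backwards, proves that the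
  families are solutions; their regularity follows by differentiating the formulas.\<close>

section \<open>Primitives of \<open>1 / (cos (2 * \<theta>) + T)\<close>\<close>

text \<open>\<open>h\<close> is, up to the factor \<open>\<rho> \<noteq> 0\<close>, a primitive of \<open>1 / (cos (2 * \<theta>) + T)\<close> on the whole set where
  this function is defined. In particular \<open>h\<close> must not jump at a pole of \<open>tan\<close>.\<close>

definition reciprocal_primitive :: "real \<Rightarrow> (real \<Rightarrow> real) \<Rightarrow> real \<Rightarrow> bool" where
  "reciprocal_primitive T h \<rho> \<longleftrightarrow>
     \<rho> \<noteq> 0 \<and> (\<forall>\<theta>. cos (2 * \<theta>) + T \<noteq> 0 \<longrightarrow>
       (h has_real_derivative \<rho> / (cos (2 * \<theta>) + T)) (at \<theta>))"

lemma tau_facts: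
  assumes "T\<^sup>2 \<noteq> 1"
  shows "tau T > 0" "(tau T)\<^sup>2 = \<bar>(T - 1) / (T + 1)\<bar>"
    and "(T_star T)\<^sup>2 = 1 / \<bar>T\<^sup>2 - 1\<bar>"
proof -
  have "T \<noteq> 1" "T \<noteq> -1" using assms by auto
  then have "\<bar>(T - 1) / (T + 1)\<bar> > 0" by auto
  then show "tau T > 0" "(tau T)\<^sup>2 = \<bar>(T - 1) / (T + 1)\<bar>" by (auto simp: tau_def)
  show "(T_star T)\<^sup>2 = 1 / \<bar>T\<^sup>2 - 1\<bar>"
    using assms by (auto simp: T_star_def power_divide)
qed

lemma tau_sq_less:
  assumes "T\<^sup>2 < 1"
  shows "(tau T)\<^sup>2 = (1 - T) / (1 + T)" "1 + T > 0" "1 - T > 0"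
proof -
  have "\<bar>T\<bar> < 1" using assms by (simp add: abs_square_less_1)
  then show *: "1 + T > 0" "1 - T > 0" by auto
  then show "(tau T)\<^sup>2 = (1 - T) / (1 + T)"
    using tau_facts(2)[of T] assms by (simp add: abs_if add.commute zero_less_divide_iff divide_less_0_iff field_simps)
qed

lemma tau_sq_greater:
  assumes "T\<^sup>2 > 1"
  shows "(tau T)\<^sup>2 = (T - 1) / (T + 1)" "T + 1 \<noteq> 0" "(T - 1) / (T + 1) > 0"
proof -
  have "\<bar>T\<bar> > 1" using assms by (simp add: abs_square_le_1 flip: not_le)
  then show *: "T + 1 \<noteq> 0" "(T - 1) / (T + 1) > 0" by (auto simp: zero_less_divide_iff)
  then show "(tau T)\<^sup>2 = (T - 1) / (T + 1)"
    using tau_facts(2)[of T] assms by (simp only: abs_of_pos)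
qed

text \<open>Writing \<open>tan\<close> as \<open>sin / cos\<close> and clearing \<open>cos\<close> gives an expression that is smooth across the poles of \<open>tan\<close>.\<close>

lemma ln_tan_eq:
  assumes "\<tau> \<noteq> 0"
  shows "ln_tan \<tau> x = ln \<bar>(\<tau> * sin x - cos x) / (\<tau> * sin x + cos x)\<bar>"
proof (cases "cos x = 0")
  case True
  then have "sin x \<noteq> 0" using sin_cos_squared_add[of x] by auto
  with True assms show ?thesis by (simp add: ln_tan_def tan_def)
next
  case False
  then have "(\<tau> * tan x - 1) / (\<tau> * tan x + 1) = (\<tau> * sin x - cos x) / (\<tau> * sin x + cos x)"
    by (simp add: tan_def divide_simps)
  then show ?thesis by (simp add: ln_tan_def)
qed

lemma ln_tan_factor:
  assumes "T\<^sup>2 < 1"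
  shows "(tau T * sin x - cos x) * (tau T * sin x + cos x) = - (cos (2 * x) + T) / (1 + T)"
proof -
  have "(tau T * sin x - cos x) * (tau T * sin x + cos x) = (tau T)\<^sup>2 * (sin x)\<^sup>2 - (cos x)\<^sup>2"
    by (simp add: algebra_simps power2_eq_square)
  also have "\<dots> = ((1 - T) / (1 + T)) * (sin x)\<^sup>2 - (cos x)\<^sup>2" using tau_sq_less[OF assms] by simp
  also have "\<dots> = ((1 - T) * (sin x)\<^sup>2 - (1 + T) * (cos x)\<^sup>2) / (1 + T)"
    using tau_sq_less[OF assms] by (simp add: field_simps)
  also have "(1 - T) * (sin x)\<^sup>2 - (1 + T) * (cos x)\<^sup>2 = - (cos (2 * x) + T)"
    unfolding cos_double sin_squared_eq by (simp add: algebra_simps)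
  finally show ?thesis .
qed

lemma DERIV_ln_abs:
  fixes f :: "real \<Rightarrow> real"
  assumes "(f has_real_derivative f') (at x)" "f x \<noteq> 0"
  shows "((\<lambda>x. ln \<bar>f x\<bar>) has_real_derivative 1 / f x * f') (at x)"
proof -
  have "((\<lambda>y. ln \<bar>y\<bar>) has_real_derivative 1 / f x) (at (f x))"
  proof (cases "f x > 0")
    case True
    have "((\<lambda>y. ln y) has_real_derivative 1 / f x) (at (f x))"
      using True by (rule DERIV_ln_divide)
    then show ?thesis
      by (rule has_field_derivative_transform_within_open[of _ _ _ "{0<..}"]) (use True in auto)
  next
    case False
    with assms(2) have neg: "f x < 0" by simp
    have "((\<lambda>y. ln (- y)) has_real_derivative 1 / f x) (at (f x))"
      using neg by (auto intro!: derivative_eq_intros)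
    then show ?thesis
      by (rule has_field_derivative_transform_within_open[of _ _ _ "{..<0}"]) (use neg in auto)
  qed
  from DERIV_chain2[OF this assms(1)] show ?thesis .
qed

lemma ln_tan_primitive:
  assumes "T\<^sup>2 < 1"
  shows "reciprocal_primitive T (ln_tan (tau T)) (- 2 * tau T * (1 + T))"
  unfolding reciprocal_primitive_def
proof (intro conjI allI impI)
  have t: "tau T > 0" "1 + T > 0" using tau_facts(1)[of T] tau_sq_less[OF assms] assms by auto
  then show "- 2 * tau T * (1 + T) \<noteq> 0" by simp
  fix \<theta> assume nz: "cos (2 * \<theta>) + T \<noteq> 0"
  let ?m = "\<lambda>x. tau T * sin x - cos x" and ?p = "\<lambda>x. tau T * sin x + cos x"
  have fac: "?m \<theta> * ?p \<theta> = - (cos (2 * \<theta>) + T) / (1 + T)" by (rule ln_tan_factor[OF assms])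
  then have nz': "?m \<theta> \<noteq> 0" "?p \<theta> \<noteq> 0" using nz t
    by (metis divide_eq_0_iff mult_eq_0_iff neg_equal_0_iff_equal less_irrefl)+
  have "((\<lambda>x. ln \<bar>?m x / ?p x\<bar>) has_real_derivative
      (1 / (?m \<theta> / ?p \<theta>)) * (((tau T * cos \<theta> + sin \<theta>) * ?p \<theta> - ?m \<theta> * (tau T * cos \<theta> - sin \<theta>)) / (?p \<theta> * ?p \<theta>))) (at \<theta>)"
    using nz' by (intro DERIV_ln_abs) (auto intro!: derivative_eq_intros simp: mult.commute)
  also have "(1 / (?m \<theta> / ?p \<theta>)) * (((tau T * cos \<theta> + sin \<theta>) * ?p \<theta> - ?m \<theta> * (tau T * cos \<theta> - sin \<theta>)) / (?p \<theta> * ?p \<theta>))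
      = ((tau T * cos \<theta> + sin \<theta>) * ?p \<theta> - ?m \<theta> * (tau T * cos \<theta> - sin \<theta>)) / (?m \<theta> * ?p \<theta>)"
    using nz' by (simp add: divide_simps)
  also have "(tau T * cos \<theta> + sin \<theta>) * ?p \<theta> - ?m \<theta> * (tau T * cos \<theta> - sin \<theta>)
      = 2 * tau T * ((sin \<theta>)\<^sup>2 + (cos \<theta>)\<^sup>2)"
    by algebra
  also have "2 * tau T * ((sin \<theta>)\<^sup>2 + (cos \<theta>)\<^sup>2) / (?m \<theta> * ?p \<theta>) = - 2 * tau T * (1 + T) / (cos (2 * \<theta>) + T)"
    unfolding fac sin_cos_squared_add using nz t by (simp add: divide_simps) (simp add: algebra_simps)
  finally have "((\<lambda>x. ln \<bar>?m x / ?p x\<bar>) has_real_derivative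
      - 2 * tau T * (1 + T) / (cos (2 * \<theta>) + T)) (at \<theta>)" .
  moreover have "ln_tan (tau T) = (\<lambda>x. ln \<bar>?m x / ?p x\<bar>)"
    using t by (intro ext ln_tan_eq) simp
  ultimately show "(ln_tan (tau T) has_real_derivative - 2 * tau T * (1 + T) / (cos (2 * \<theta>) + T)) (at \<theta>)"
    by (simp only:)
qed

lemma tan_pow_primitive:
  assumes "T\<^sup>2 = 1"
  shows "reciprocal_primitive T (tan_pow T) 2"
  unfolding reciprocal_primitive_def
proof (intro conjI allI impI)
  fix \<theta> assume nz: "cos (2 * \<theta>) + T \<noteq> 0"
  consider "T = 1" | "T = -1" using assms by (auto simp: power2_eq_1_iff)
  then show "(tan_pow T has_real_derivative 2 / (cos (2 * \<theta>) + T)) (at \<theta>)"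
  proof cases
    case 1
    have e: "cos (2 * \<theta>) + T = 2 * (cos \<theta>)\<^sup>2" by (simp add: 1 cos_double_cos)
    have "tan_pow T = tan" by (simp add: tan_pow_def 1 fun_eq_iff)
    moreover have "(tan has_real_derivative inverse ((cos \<theta>)\<^sup>2)) (at \<theta>)"
      using nz e by (intro DERIV_tan) auto
    ultimately show ?thesis by (simp add: e inverse_eq_divide)
  next
    case 2
    have e: "cos (2 * \<theta>) + T = - 2 * (sin \<theta>)\<^sup>2" by (simp add: 2 cos_double_sin)
    have "tan_pow T = cot" by (simp add: tan_pow_def 2 fun_eq_iff tan_def cot_def)
    moreover have "(cot has_real_derivative - inverse ((sin \<theta>)\<^sup>2)) (at \<theta>)"
      using nz e by (intro DERIV_cot) auto
    ultimately show ?thesis by (simp add: e inverse_eq_divide)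
  qed
qed auto

lemma arctan_tan_denom_pos:
  fixes \<tau> x :: real
  assumes "\<tau> > 0"
  shows "(cos x)\<^sup>2 + \<tau> * (sin x)\<^sup>2 > 0"
proof (cases "sin x = 0")
  case True
  then show ?thesis using sin_cos_squared_add[of x] by simp
next
  case False
  then show ?thesis using assms by (simp add: add_nonneg_pos)
qed

text \<open>The continuous branch of \<open>arctan (\<tau> * tan x)\<close> in a closed form without case distinctions: for
  \<open>\<bar>x\<bar> < pi / 2\<close> the angles \<open>x\<close> and \<open>arctan (\<tau> * tan x)\<close> have the same sign, so their difference lies in
  \<open>(- pi / 2, pi / 2)\<close> and is the \<open>arctan\<close> of its tangent.\<close>

lemma arctan_tan_eq:
  assumes "\<tau> > 0"
  shows "arctan_tan \<tau> x = x + arctan ((\<tau> - 1) * sin x * cos x / ((cos x)\<^sup>2 + \<tau> * (sin x)\<^sup>2))"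
proof (cases "cos x = 0")
  case True
  then show ?thesis by (simp add: arctan_tan_def)
next
  case False
  define n where "n = round (x / pi)"
  define y where "y = x - of_int n * pi"
  have tan: "tan y = tan x"
    using tan_periodic_int[of y n] by (simp add: y_def)
  have "\<bar>of_int n - x / pi\<bar> \<le> 1/2" unfolding n_def by (rule of_int_round_abs_le)
  then have "\<bar>(of_int n - x / pi) * pi\<bar> \<le> 1/2 * pi" by (simp add: abs_mult)
  then have y_le: "\<bar>y\<bar> \<le> pi / 2" unfolding y_def by (simp add: algebra_simps abs_minus_commute)
  have "cos x = cos (y + of_int n * pi)" by (simp add: y_def)
  also have "\<dots> = cos y * cos (of_int n * pi)"
    by (simp add: cos_add sin_zero_iff_int2)
  finally have "cos y \<noteq> 0" using False by auto
  then have "y \<noteq> pi / 2" "y \<noteq> - (pi / 2)" by (metis cos_pi_half, metis cos_minus cos_pi_half)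
  then have y: "- (pi / 2) < y" "y < pi / 2"
    using y_le by linarith+
  define a where "a = arctan (\<tau> * tan y)"
  have a: "- (pi / 2) < a" "a < pi / 2" "tan a = \<tau> * tan y" "cos a \<noteq> 0"
    unfolding a_def using arctan[of "\<tau> * tan y"] by auto
  have "tan y > 0 \<longleftrightarrow> y > 0" "tan y < 0 \<longleftrightarrow> y < 0"
    using y tan_gt_zero[of y] tan_gt_zero[of "-y"] tan_zero
    by (metis linorder_less_linear minus_less_iff neg_0_less_iff_less order_less_imp_not_less tan_minus)+
  moreover have "a > 0 \<longleftrightarrow> tan y > 0" "a < 0 \<longleftrightarrow> tan y < 0"
    using assms by (auto simp: a_def zero_less_mult_iff mult_less_0_iff)
  ultimately have ay: "- (pi / 2) < a - y" "a - y < pi / 2"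
    using a y by linarith+
  then have "cos (a - y) \<noteq> 0" using cos_gt_zero_pi[of "a - y"] by simp
  then have "tan (a - y) = (tan a - tan y) / (1 + tan a * tan y)"
    using a \<open>cos y \<noteq> 0\<close> by (intro tan_diff)
  also have "\<dots> = (\<tau> - 1) * tan x / (1 + \<tau> * (tan x)\<^sup>2)"
    by (simp add: a tan algebra_simps power2_eq_square)
  also have "\<dots> = (\<tau> - 1) * sin x * cos x / ((cos x)\<^sup>2 + \<tau> * (sin x)\<^sup>2)"
  proof -
    have "1 + \<tau> * (tan x)\<^sup>2 = ((cos x)\<^sup>2 + \<tau> * (sin x)\<^sup>2) / (cos x)\<^sup>2"
      using False by (simp add: tan_def power_divide add_divide_distrib)
    then show ?thesis using False by (simp add: tan_def power2_eq_square)
  qed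
  finally have "arctan ((\<tau> - 1) * sin x * cos x / ((cos x)\<^sup>2 + \<tau> * (sin x)\<^sup>2)) = a - y"
    using ay by (intro arctan_unique) auto
  moreover have "arctan_tan \<tau> x = a + of_int n * pi"
    using False by (simp add: arctan_tan_def a_def tan n_def)
  ultimately show ?thesis by (simp add: y_def)
qed

lemma arctan_tan_denom_sq:
  fixes \<tau> x :: real
  shows "((cos x)\<^sup>2 + \<tau> * (sin x)\<^sup>2)\<^sup>2 + ((\<tau> - 1) * sin x * cos x)\<^sup>2 = (cos x)\<^sup>2 + \<tau>\<^sup>2 * (sin x)\<^sup>2"
proof -
  have "((cos x)\<^sup>2 + \<tau> * (sin x)\<^sup>2)\<^sup>2 + ((\<tau> - 1) * sin x * cos x)\<^sup>2
      = ((cos x)\<^sup>2 + \<tau>\<^sup>2 * (sin x)\<^sup>2) * ((sin x)\<^sup>2 + (cos x)\<^sup>2)"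
    by algebra
  then show ?thesis by simp
qed

lemma arctan_tan_factor:
  assumes "T\<^sup>2 > 1"
  shows "(cos x)\<^sup>2 + (tau T)\<^sup>2 * (sin x)\<^sup>2 = (cos (2 * x) + T) / (T + 1)"
proof -
  note t = tau_sq_greater[OF assms]
  have "(cos x)\<^sup>2 + (tau T)\<^sup>2 * (sin x)\<^sup>2 = ((T + 1) * (cos x)\<^sup>2 + (T - 1) * (sin x)\<^sup>2) / (T + 1)"
    unfolding t(1) using t(2) by (simp add: divide_simps)
  also have "(T + 1) * (cos x)\<^sup>2 + (T - 1) * (sin x)\<^sup>2 = cos (2 * x) + T"
    unfolding cos_double sin_squared_eq by (simp add: algebra_simps)
  finally show ?thesis .
qed

lemma arctan_tan_primitive:
  assumes "T\<^sup>2 > 1"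
  shows "reciprocal_primitive T (arctan_tan (tau T)) (tau T * (T + 1))"
  unfolding reciprocal_primitive_def
proof (intro conjI allI impI)
  define \<tau> where "\<tau> = tau T"
  have pos: "\<tau> > 0" using tau_facts(1)[of T] assms by (auto simp: \<tau>_def)
  then show "tau T * (T + 1) \<noteq> 0" using tau_sq_greater[OF assms] by (simp add: \<tau>_def)
  fix \<theta> assume nz: "cos (2 * \<theta>) + T \<noteq> 0"
  let ?e = "\<lambda>x. (cos x)\<^sup>2 + \<tau> * (sin x)\<^sup>2" and ?n = "\<lambda>x. (\<tau> - 1) * sin x * cos x"
  let ?d = "(cos \<theta>)\<^sup>2 + \<tau>\<^sup>2 * (sin \<theta>)\<^sup>2"
  have e: "?e \<theta> > 0" by (rule arctan_tan_denom_pos[OF pos])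
  have dpos: "?d > 0" using arctan_tan_denom_pos[of "\<tau>\<^sup>2" \<theta>] pos by simp
  have inv: "1 + (?n \<theta> / ?e \<theta>)\<^sup>2 = ?d / (?e \<theta>)\<^sup>2"
    unfolding arctan_tan_denom_sq[of \<theta> \<tau>, symmetric] using e by (simp add: power_divide add_divide_distrib)
  let ?n' = "(\<tau> - 1) * ((cos \<theta>)\<^sup>2 - (sin \<theta>)\<^sup>2)" and ?e' = "2 * (\<tau> - 1) * sin \<theta> * cos \<theta>"
  have "((\<lambda>x. x + arctan (?n x / ?e x)) has_real_derivative
       1 + (?n' * ?e \<theta> - ?n \<theta> * ?e') / (?e \<theta> * ?e \<theta>) * inverse (1 + (?n \<theta> / ?e \<theta>)\<^sup>2)) (at \<theta>)"
    using e by (auto intro!: derivative_eq_intros simp: algebra_simps power2_eq_square)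
  also have "1 + (?n' * ?e \<theta> - ?n \<theta> * ?e') / (?e \<theta> * ?e \<theta>) * inverse (1 + (?n \<theta> / ?e \<theta>)\<^sup>2)
      = (?d + (?n' * ?e \<theta> - ?n \<theta> * ?e')) / ?d"
    unfolding inv using e dpos by (simp add: divide_simps power2_eq_square)
  also have "?d + (?n' * ?e \<theta> - ?n \<theta> * ?e') = \<tau> * ((sin \<theta>)\<^sup>2 + (cos \<theta>)\<^sup>2)\<^sup>2 + ?d * (1 - ((sin \<theta>)\<^sup>2 + (cos \<theta>)\<^sup>2))"
    by algebra
  also have "(\<tau> * ((sin \<theta>)\<^sup>2 + (cos \<theta>)\<^sup>2)\<^sup>2 + ?d * (1 - ((sin \<theta>)\<^sup>2 + (cos \<theta>)\<^sup>2))) / ?d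
      = tau T * (T + 1) / (cos (2 * \<theta>) + T)"
    using arctan_tan_factor[OF assms, of \<theta>] by (simp add: \<tau>_def)
  finally show "(arctan_tan (tau T) has_real_derivative tau T * (T + 1) / (cos (2 * \<theta>) + T)) (at \<theta>)"
    using arctan_tan_eq[OF pos] unfolding \<tau>_def by presburger
qed

section \<open>Addition laws\<close>

text \<open>With \<open>g\<^sub>k = D * h + \<mu>\<^sub>k\<close>, the argument of \<open>w\<close> in \<open>G\<close> is \<open>D * (h \<theta> + h \<eta>)\<close>. The law expresses
  \<open>\<bar>w\<bar>\<close> through the three functions whose logarithms occur in \<open>F\<close>, \<open>f\<^sub>1\<close> and \<open>f\<^sub>2\<close>.\<close>

definition addition_law ::
    "real \<Rightarrow> (real \<Rightarrow> real) \<Rightarrow> (real \<Rightarrow> real) \<Rightarrow> real \<Rightarrow> real \<Rightarrow> real \<Rightarrow> bool" where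
  "addition_law T h w D \<theta> \<eta> \<longleftrightarrow>
     (w (D * (h \<theta> + h \<eta>)))\<^sup>2 * \<bar>(cos (2 * \<theta>) + T) * (cos (2 * \<eta>) + T)\<bar> = (sin (\<theta> + \<eta>))\<^sup>2"

lemma exp_half_sq: "(exp (v / 2))\<^sup>2 = exp (v::real)"
  by (simp flip: exp_double)

lemma sinh_half_sq: "(sinh (v / 2))\<^sup>2 = (exp v - 1)\<^sup>2 / (4 * exp (v::real))"
proof -
  have "sinh (v / 2) = (exp v - 1) / (2 * exp (v / 2))"
    by (simp add: sinh_field_def field_simps exp_half_sq flip: power2_eq_square exp_add)
  then show ?thesis by (simp add: power_divide power_mult_distrib exp_half_sq)
qed

lemma cosh_half_sq: "(cosh (v / 2))\<^sup>2 = (exp v + 1)\<^sup>2 / (4 * exp (v::real))"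
proof -
  have "cosh (v / 2) = (exp v + 1) / (2 * exp (v / 2))"
    by (simp add: cosh_field_def field_simps exp_half_sq flip: power2_eq_square exp_add)
  then show ?thesis by (simp add: power_divide power_mult_distrib exp_half_sq)
qed

text \<open>Both cases of \<open>T\<^sup>2 < 1\<close> rest on the identity for \<open>(R - 1)\<^sup>2 / (4 * R)\<close>, where \<open>\<bar>R\<bar>\<close> is the
  exponential of \<open>v = h \<theta> + h \<eta>\<close>: this quotient is \<open>(sinh (v / 2))\<^sup>2\<close> for \<open>R > 0\<close> and
  \<open>- (cosh (v / 2))\<^sup>2\<close> for \<open>R < 0\<close>.\<close>

lemma ln_tan_addition:
  assumes T: "T\<^sup>2 < 1" and nz: "cos (2 * \<theta>) + T \<noteq> 0" "cos (2 * \<eta>) + T \<noteq> 0"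
  defines "R \<equiv> (tau T * sin \<theta> - cos \<theta>) / (tau T * sin \<theta> + cos \<theta>) *
                ((tau T * sin \<eta> - cos \<eta>) / (tau T * sin \<eta> + cos \<eta>))"
  shows "exp (ln_tan (tau T) \<theta> + ln_tan (tau T) \<eta>) = \<bar>R\<bar>"
    and "R > 0 \<longleftrightarrow> (cos (2 * \<theta>) + T) * (cos (2 * \<eta>) + T) > 0" and "R \<noteq> 0"
    and "(T_star T)\<^sup>2 * ((R - 1)\<^sup>2 / (4 * R)) * ((cos (2 * \<theta>) + T) * (cos (2 * \<eta>) + T)) = (sin (\<theta> + \<eta>))\<^sup>2"
proof -
  define t where "t = tau T"
  have t: "t > 0" "1 + T > 0" "1 - T > 0" "t\<^sup>2 = (1 - T) / (1 + T)"
    using tau_facts(1)[of T] tau_sq_less[OF T] T by (auto simp: t_def)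
  define m1 where "m1 = t * sin \<theta> - cos \<theta>"
  define p1 where "p1 = t * sin \<theta> + cos \<theta>"
  define m2 where "m2 = t * sin \<eta> - cos \<eta>"
  define p2 where "p2 = t * sin \<eta> + cos \<eta>"
  have R: "R = m1 / p1 * (m2 / p2)" by (simp add: R_def m1_def p1_def m2_def p2_def t_def)
  have f1: "cos (2 * \<theta>) + T = - (1 + T) * (m1 * p1)"
    using ln_tan_factor[OF T, of \<theta>] t by (simp add: m1_def p1_def t_def field_simps)
  have f2: "cos (2 * \<eta>) + T = - (1 + T) * (m2 * p2)"
    using ln_tan_factor[OF T, of \<eta>] t by (simp add: m2_def p2_def t_def field_simps)
  have nz': "m1 \<noteq> 0" "p1 \<noteq> 0" "m2 \<noteq> 0" "p2 \<noteq> 0" using nz unfolding f1 f2 by auto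
  show "R \<noteq> 0" using nz' by (simp add: R)
  have "ln_tan t \<theta> = ln \<bar>m1 / p1\<bar>" "ln_tan t \<eta> = ln \<bar>m2 / p2\<bar>"
    using t by (simp_all add: ln_tan_eq m1_def p1_def m2_def p2_def)
  then show "exp (ln_tan (tau T) \<theta> + ln_tan (tau T) \<eta>) = \<bar>R\<bar>"
    using nz' by (simp add: exp_add R abs_mult flip: t_def)
  have prod: "(cos (2 * \<theta>) + T) * (cos (2 * \<eta>) + T) = ((1 + T) * (p1 * p2))\<^sup>2 * R"
    using nz' unfolding f1 f2 R by (simp add: field_simps power2_eq_square)
  then show "R > 0 \<longleftrightarrow> (cos (2 * \<theta>) + T) * (cos (2 * \<eta>) + T) > 0"
    using nz' t by (simp add: zero_less_mult_iff)
  have "(R - 1) * (p1 * p2) = m1 * m2 - p1 * p2"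
    using nz' by (simp add: R left_diff_distrib)
  then have "(R - 1)\<^sup>2 * (p1 * p2)\<^sup>2 = (m1 * m2 - p1 * p2)\<^sup>2"
    by (metis power_mult_distrib)
  also have "m1 * m2 - p1 * p2 = - 2 * t * sin (\<theta> + \<eta>)"
    by (simp add: m1_def m2_def p1_def p2_def sin_add algebra_simps)
  also have "(- 2 * t * sin (\<theta> + \<eta>))\<^sup>2 = 4 * ((1 - T) / (1 + T)) * (sin (\<theta> + \<eta>))\<^sup>2"
    by (simp add: power_mult_distrib t(4))
  finally have *: "(R - 1)\<^sup>2 * (p1 * p2)\<^sup>2 = 4 * ((1 - T) / (1 + T)) * (sin (\<theta> + \<eta>))\<^sup>2" .
  have ts: "(T_star T)\<^sup>2 = 1 / ((1 - T) * (1 + T))"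
    using tau_facts(3)[of T] T by (simp add: power2_eq_square algebra_simps)
  have "(T_star T)\<^sup>2 * ((R - 1)\<^sup>2 / (4 * R)) * ((cos (2 * \<theta>) + T) * (cos (2 * \<eta>) + T))
      = (1 + T) / (4 * (1 - T)) * ((R - 1)\<^sup>2 * (p1 * p2)\<^sup>2)"
  proof -
    have "1 / ((1 - T) * (1 + T)) * (X / (4 * R)) * (((1 + T) * P)\<^sup>2 * R) = (1 + T) / (4 * (1 - T)) * (X * P\<^sup>2)"
      for X P using \<open>R \<noteq> 0\<close> t by (simp add: power2_eq_square) (simp add: ac_simps)
    then show ?thesis unfolding prod ts .
  qed
  also have "\<dots> = (sin (\<theta> + \<eta>))\<^sup>2" unfolding * using t by simp
  finally show "(T_star T)\<^sup>2 * ((R - 1)\<^sup>2 / (4 * R)) * ((cos (2 * \<theta>) + T) * (cos (2 * \<eta>) + T)) = (sin (\<theta> + \<eta>))\<^sup>2" .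
qed

lemma addition_law_sinh:
  assumes T: "T\<^sup>2 < 1" and pos: "(cos (2 * \<theta>) + T) * (cos (2 * \<eta>) + T) > 0" and D: "D \<noteq> 0"
  shows "addition_law T (ln_tan (tau T)) (\<lambda>v. T_star T * sinh (v / (2 * D))) D \<theta> \<eta>"
proof -
  define R where "R = (tau T * sin \<theta> - cos \<theta>) / (tau T * sin \<theta> + cos \<theta>) *
                ((tau T * sin \<eta> - cos \<eta>) / (tau T * sin \<eta> + cos \<eta>))"
  have nz: "cos (2 * \<theta>) + T \<noteq> 0" "cos (2 * \<eta>) + T \<noteq> 0" using pos by auto
  note L = ln_tan_addition[OF T nz, folded R_def]
  have "R > 0" using L(2) pos by simp
  have "(sinh ((ln_tan (tau T) \<theta> + ln_tan (tau T) \<eta>) / 2))\<^sup>2 = (R - 1)\<^sup>2 / (4 * R)"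
    using \<open>R > 0\<close> by (simp add: sinh_half_sq L(1))
  then show ?thesis
    using D L(4) pos by (simp add: addition_law_def power_mult_distrib)
qed

lemma addition_law_cosh:
  assumes T: "T\<^sup>2 < 1" and neg: "(cos (2 * \<theta>) + T) * (cos (2 * \<eta>) + T) < 0" and D: "D \<noteq> 0"
  shows "addition_law T (ln_tan (tau T)) (\<lambda>v. T_star T * cosh (v / (2 * D))) D \<theta> \<eta>"
proof -
  define R where "R = (tau T * sin \<theta> - cos \<theta>) / (tau T * sin \<theta> + cos \<theta>) *
                ((tau T * sin \<eta> - cos \<eta>) / (tau T * sin \<eta> + cos \<eta>))"
  have nz: "cos (2 * \<theta>) + T \<noteq> 0" "cos (2 * \<eta>) + T \<noteq> 0" using neg by auto
  note L = ln_tan_addition[OF T nz, folded R_def]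
  have "R < 0" using L(2,3) neg by auto
  have "(cosh ((ln_tan (tau T) \<theta> + ln_tan (tau T) \<eta>) / 2))\<^sup>2 = - ((R - 1)\<^sup>2 / (4 * R))"
    using \<open>R < 0\<close> by (simp add: cosh_half_sq L(1)) (simp add: power2_eq_square algebra_simps)
  then show ?thesis
    using D L(4) neg by (simp add: addition_law_def power_mult_distrib)
qed

lemma addition_law_tan_pow:
  assumes T: "T\<^sup>2 = 1" and nz: "cos (2 * \<theta>) + T \<noteq> 0" "cos (2 * \<eta>) + T \<noteq> 0" and D: "D \<noteq> 0"
  shows "addition_law T (tan_pow T) (\<lambda>v. v / (2 * D)) D \<theta> \<eta>"
proof -
  consider "T = 1" | "T = -1" using T by (auto simp: power2_eq_1_iff)
  then show ?thesis
  proof cases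
    case 1
    have e: "cos (2 * x) + 1 = 2 * (cos x)\<^sup>2" for x :: real by (simp add: cos_double_cos)
    have c: "cos \<theta> \<noteq> 0" "cos \<eta> \<noteq> 0" using nz unfolding 1 e by auto
    have "tan \<theta> + tan \<eta> = sin (\<theta> + \<eta>) / (cos \<theta> * cos \<eta>)"
      using c by (simp add: tan_def sin_add field_simps)
    then show ?thesis
      using D c unfolding addition_law_def tan_pow_def 1 e
      by (simp add: power_divide power_mult_distrib abs_mult)
  next
    case 2
    have e: "cos (2 * x) + -1 = - (2 * (sin x)\<^sup>2)" for x :: real by (simp add: cos_double_sin)
    have c: "sin \<theta> \<noteq> 0" "sin \<eta> \<noteq> 0" using nz unfolding 2 e by auto
    have "1 / tan \<theta> + 1 / tan \<eta> = sin (\<theta> + \<eta>) / (sin \<theta> * sin \<eta>)"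
      using c by (simp add: tan_def sin_add field_simps)
    then show ?thesis
      using D c unfolding addition_law_def tan_pow_def 2 e
      by (simp add: power_divide power_mult_distrib abs_mult)
  qed
qed

text \<open>The angle \<open>arctan_tan \<tau> x\<close> is an argument of a multiple of the vector \<open>(cos x, \<tau> * sin x)\<close>.\<close>

lemma arctan_tan_polar:
  assumes "\<tau> > 0"
  obtains r where "r\<^sup>2 * ((cos x)\<^sup>2 + \<tau>\<^sup>2 * (sin x)\<^sup>2) = 1"
    "cos (arctan_tan \<tau> x) = r * cos x" "sin (arctan_tan \<tau> x) = r * \<tau> * sin x"
proof
  define e where "e = (cos x)\<^sup>2 + \<tau> * (sin x)\<^sup>2"
  define q where "q = (\<tau> - 1) * sin x * cos x"
  have e: "e > 0" unfolding e_def by (rule arctan_tan_denom_pos[OF assms])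
  define a where "a = arctan (q / e)"
  have a: "tan a = q / e" "cos a \<noteq> 0" by (simp_all add: a_def arctan)
  have h: "arctan_tan \<tau> x = x + a" by (simp add: arctan_tan_eq[OF assms] a_def e_def q_def)
  have sa: "sin a = cos a * (q / e)" using a by (simp add: tan_def field_simps)
  have "cos x * e - sin x * q = cos x * ((sin x)\<^sup>2 + (cos x)\<^sup>2)"
    "sin x * e + cos x * q = \<tau> * sin x * ((sin x)\<^sup>2 + (cos x)\<^sup>2)"
    unfolding e_def q_def by algebra+
  then have *: "cos x * e - sin x * q = cos x" "sin x * e + cos x * q = \<tau> * sin x" by simp_all
  have "cos (x + a) = cos a / e * (cos x * e - sin x * q)"
    "sin (x + a) = cos a / e * (sin x * e + cos x * q)"
    using e by (simp_all add: cos_add sin_add sa field_simps)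
  then show "cos (arctan_tan \<tau> x) = cos a / e * cos x" "sin (arctan_tan \<tau> x) = cos a / e * \<tau> * sin x"
    unfolding * h by simp_all
  have "(cos a / e)\<^sup>2 * (e\<^sup>2 + q\<^sup>2) = (cos a)\<^sup>2 + (cos a * (q / e))\<^sup>2"
    using e by (simp add: power_divide field_simps)
  also have "\<dots> = 1" unfolding sa[symmetric] by simp
  finally show "(cos a / e)\<^sup>2 * ((cos x)\<^sup>2 + \<tau>\<^sup>2 * (sin x)\<^sup>2) = 1"
    unfolding e_def q_def arctan_tan_denom_sq .
qed

lemma addition_law_arctan_tan:
  assumes T: "T\<^sup>2 > 1" and nz: "cos (2 * \<theta>) + T \<noteq> 0" "cos (2 * \<eta>) + T \<noteq> 0" and D: "D \<noteq> 0"
  shows "addition_law T (arctan_tan (tau T)) (\<lambda>v. T_star T * sin (v / D)) D \<theta> \<eta>"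
proof -
  define \<tau> where "\<tau> = tau T"
  have \<tau>: "\<tau> > 0" using tau_facts(1)[of T] T by (auto simp: \<tau>_def)
  have \<tau>2: "\<tau>\<^sup>2 = (T - 1) / (T + 1)" and T1: "T + 1 \<noteq> 0" "(T - 1) / (T + 1) > 0"
    using tau_sq_greater[OF T] by (auto simp: \<tau>_def)
  obtain r where r: "r\<^sup>2 * ((cos \<theta>)\<^sup>2 + \<tau>\<^sup>2 * (sin \<theta>)\<^sup>2) = 1"
    "cos (arctan_tan \<tau> \<theta>) = r * cos \<theta>" "sin (arctan_tan \<tau> \<theta>) = r * \<tau> * sin \<theta>"
    using arctan_tan_polar[OF \<tau>] by blast
  obtain s where s: "s\<^sup>2 * ((cos \<eta>)\<^sup>2 + \<tau>\<^sup>2 * (sin \<eta>)\<^sup>2) = 1"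
    "cos (arctan_tan \<tau> \<eta>) = s * cos \<eta>" "sin (arctan_tan \<tau> \<eta>) = s * \<tau> * sin \<eta>"
    using arctan_tan_polar[OF \<tau>] by blast
  have r2: "r\<^sup>2 * (cos (2 * \<theta>) + T) = T + 1" and s2: "s\<^sup>2 * (cos (2 * \<eta>) + T) = T + 1"
    using r(1) s(1) T1(1) unfolding arctan_tan_factor[OF T, folded \<tau>_def] by (simp_all add: field_simps)
  have "sin (arctan_tan \<tau> \<theta> + arctan_tan \<tau> \<eta>) = r * s * \<tau> * sin (\<theta> + \<eta>)"
    by (simp add: sin_add r s algebra_simps)
  then have sq: "(sin (arctan_tan \<tau> \<theta> + arctan_tan \<tau> \<eta>))\<^sup>2 = r\<^sup>2 * s\<^sup>2 * \<tau>\<^sup>2 * (sin (\<theta> + \<eta>))\<^sup>2"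
    by (simp add: power_mult_distrib)
  have rs: "r\<^sup>2 * s\<^sup>2 * ((cos (2 * \<theta>) + T) * (cos (2 * \<eta>) + T)) = (T + 1)\<^sup>2"
    using arg_cong2[OF r2 s2, of "(*)"] by (simp add: power2_eq_square algebra_simps)
  have "r \<noteq> 0" "s \<noteq> 0" using r(1) s(1) by auto
  then have "r\<^sup>2 * s\<^sup>2 > 0" by simp
  have "(T + 1)\<^sup>2 > 0" using T1 by simp
  then have "(cos (2 * \<theta>) + T) * (cos (2 * \<eta>) + T) > 0"
    using \<open>r\<^sup>2 * s\<^sup>2 > 0\<close> rs by (metis zero_less_mult_pos)
  then have abs: "\<bar>(cos (2 * \<theta>) + T) * (cos (2 * \<eta>) + T)\<bar> = (cos (2 * \<theta>) + T) * (cos (2 * \<eta>) + T)"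
    by simp
  have ts: "(T_star T)\<^sup>2 = 1 / ((T - 1) * (T + 1))"
    using tau_facts(3)[of T] T by (simp add: power2_eq_square algebra_simps)
  have "T - 1 \<noteq> 0" using T by auto
  have "(T_star T * sin (D * (arctan_tan \<tau> \<theta> + arctan_tan \<tau> \<eta>) / D))\<^sup>2 *
      \<bar>(cos (2 * \<theta>) + T) * (cos (2 * \<eta>) + T)\<bar>
      = (T_star T)\<^sup>2 * \<tau>\<^sup>2 * (r\<^sup>2 * s\<^sup>2 * ((cos (2 * \<theta>) + T) * (cos (2 * \<eta>) + T))) * (sin (\<theta> + \<eta>))\<^sup>2"
    using D unfolding abs by (simp add: power_mult_distrib sq)
  also have "\<dots> = (sin (\<theta> + \<eta>))\<^sup>2"
    unfolding rs ts \<tau>2 using T1 \<open>T - 1 \<noteq> 0\<close> by (simp add: power2_eq_square)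
  finally show ?thesis unfolding addition_law_def \<tau>_def .
qed

section \<open>The families solve the functional equation\<close>

text \<open>The indices of \<open>f\<close> and \<open>g\<close> are to stay in the form \<open>1\<close> and \<open>2\<close>.\<close>

declare One_nat_def [simp del]

lemma ln_abs_product:
  fixes w a b s :: real
  assumes "w\<^sup>2 * \<bar>a * b\<bar> = s\<^sup>2" and nz: "w \<noteq> 0" "a \<noteq> 0" "b \<noteq> 0" "s \<noteq> 0"
  shows "2 * ln \<bar>w\<bar> + ln \<bar>a\<bar> + ln \<bar>b\<bar> = 2 * ln \<bar>s\<bar>"
proof -
  have pos: "\<bar>w\<bar> > 0" "\<bar>a\<bar> > 0" "\<bar>b\<bar> > 0" "\<bar>s\<bar> > 0" using nz by simp_all
  have "\<bar>w\<bar> * \<bar>w\<bar> * (\<bar>a\<bar> * \<bar>b\<bar>) = \<bar>s\<bar> * \<bar>s\<bar>"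
    using assms(1) by (simp add: abs_mult power2_eq_square)
  then have "ln (\<bar>w\<bar> * \<bar>w\<bar> * (\<bar>a\<bar> * \<bar>b\<bar>)) = ln (\<bar>s\<bar> * \<bar>s\<bar>)" by (simp only:)
  moreover have "ln (\<bar>w\<bar> * \<bar>w\<bar> * (\<bar>a\<bar> * \<bar>b\<bar>)) = ln \<bar>w\<bar> + ln \<bar>w\<bar> + (ln \<bar>a\<bar> + ln \<bar>b\<bar>)"
    by (simp only: ln_mult_pos mult_pos_pos pos)
  moreover have "ln (\<bar>s\<bar> * \<bar>s\<bar>) = ln \<bar>s\<bar> + ln \<bar>s\<bar>"
    by (simp only: ln_mult_pos mult_pos_pos pos)
  ultimately show ?thesis by simp
qed

text \<open>The value that \<open>F\<close> and \<open>f\<close> force on \<open>G\<close>, for an arbitrary pair \<open>h\<close>, \<open>w\<close> obeying the addition law.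
  It serves both directions: it verifies the equation when \<open>G\<close> is given, and it yields \<open>G\<close> when the
  equation is given.\<close>

lemma family_satisfies_E:
  assumes F: "F_form I F A B \<alpha> \<beta>\<^sub>0 l\<^sub>0" and fg: "fg_form I h f g A B C D T \<alpha> \<beta> l \<mu>"
    and \<beta>: "\<beta> 1 + \<beta> 2 = of_int n * pi + \<beta>\<^sub>0" and D: "D \<noteq> 0"
    and add: "addition_law T h w D (\<alpha> * x + \<beta> 1) (\<alpha> * y + \<beta> 2)"
    and x: "x \<in> I" and y: "y \<in> I" and m: "(x + y) / 2 \<in> I"
  defines "v \<equiv> g 1 x + g 2 y - (\<mu> 1 + \<mu> 2)"
  shows "w v \<noteq> 0"
    and "F ((x + y) / 2) + f 1 x + f 2 y
          = 2 * A * ln \<bar>w v\<bar> + C * (v / D) + (l\<^sub>0 + l 1 + l 2)"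
proof -
  let ?\<theta> = "\<alpha> * x + \<beta> 1" and ?\<eta> = "\<alpha> * y + \<beta> 2"
  let ?s = "sin (2 * \<alpha> * ((x + y) / 2) + \<beta>\<^sub>0)"
  let ?c1 = "cos (2 * ?\<theta>) + T" and ?c2 = "cos (2 * ?\<eta>) + T"
  have s: "?s \<noteq> 0" and Fm: "F ((x + y) / 2) = 2 * A * ln \<bar>?s\<bar> + 2 * B * ((x + y) / 2) + l\<^sub>0"
    using F m by (auto simp: F_form_def)
  have e: "2 * (\<alpha> * z + \<beta> k) = 2 * \<alpha> * z + 2 * \<beta> k" for z k by (simp add: algebra_simps)
  have key: "cos (2 * (\<alpha> * z + \<beta> k)) + T \<noteq> 0"
    "f k z = - A * ln \<bar>cos (2 * (\<alpha> * z + \<beta> k)) + T\<bar> - B * z + C * h (\<alpha> * z + \<beta> k) + l k"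
    "g k z = D * h (\<alpha> * z + \<beta> k) + \<mu> k" if "z \<in> I" "k \<in> {1, 2}" for z k
    using fg that unfolding fg_form_def e by blast+
  have c1: "?c1 \<noteq> 0" and f1: "f 1 x = - A * ln \<bar>?c1\<bar> - B * x + C * h ?\<theta> + l 1"
    and g1: "g 1 x = D * h ?\<theta> + \<mu> 1"
    using key[OF x, of 1] by blast+
  have c2: "?c2 \<noteq> 0" and f2: "f 2 y = - A * ln \<bar>?c2\<bar> - B * y + C * h ?\<eta> + l 2"
    and g2: "g 2 y = D * h ?\<eta> + \<mu> 2"
    using key[OF y, of 2] by blast+
  have sin0: "sin (of_int n * pi) = 0" by (simp add: sin_zero_iff_int2)
  have v: "v = D * (h ?\<theta> + h ?\<eta>)" by (simp add: v_def g1 g2 algebra_simps)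
  \<comment> \<open>The relation between the phases makes the two sines equal up to sign.\<close>
  have "?\<theta> + ?\<eta> = (2 * \<alpha> * ((x + y) / 2) + \<beta>\<^sub>0) + of_int n * pi"
    using \<beta> by (simp add: field_simps)
  then have "sin (?\<theta> + ?\<eta>) = sin ((2 * \<alpha> * ((x + y) / 2) + \<beta>\<^sub>0) + of_int n * pi)" by (rule arg_cong)
  also have "\<dots> = ?s * cos (of_int n * pi) + cos (2 * \<alpha> * ((x + y) / 2) + \<beta>\<^sub>0) * sin (of_int n * pi)"
    by (rule sin_add)
  finally have "sin (?\<theta> + ?\<eta>) = ?s * cos (of_int n * pi)" unfolding sin0 by (simp only: mult_zero_right add_0_right)
  then have "(sin (?\<theta> + ?\<eta>))\<^sup>2 = ?s\<^sup>2 * (cos (of_int n * pi))\<^sup>2" by (simp only: power_mult_distrib)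
  also have "(cos (of_int n * pi))\<^sup>2 = 1"
    using sin_cos_squared_add[of "of_int n * pi"] unfolding sin0 by (simp only: power_zero_numeral add_0_left)
  finally have "(sin (?\<theta> + ?\<eta>))\<^sup>2 = ?s\<^sup>2" by (simp only: mult_1_right)
  with add have law: "(w v)\<^sup>2 * \<bar>?c1 * ?c2\<bar> = ?s\<^sup>2" unfolding addition_law_def v by (simp only:)
  have "?s\<^sup>2 \<noteq> 0" using s by (rule power_not_zero)
  then show w: "w v \<noteq> 0" unfolding law[symmetric] by auto
  have "2 * B * ((x + y) / 2) = B * x + B * y" by (simp add: algebra_simps)
  then have collect: "(2 * A * S + 2 * B * ((x + y) / 2) + l\<^sub>0) + (- A * S1 - B * x + C * H1 + l 1)
       + (- A * S2 - B * y + C * H2 + l 2) = 2 * A * W + C * V + (l\<^sub>0 + l 1 + l 2)"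
    if "2 * A * S - A * S1 - A * S2 = 2 * A * W" "C * V = C * H1 + C * H2" for S S1 S2 W H1 H2 V
    using that by linarith
  from ln_abs_product[OF law w c1 c2 s]
  have "A * (2 * ln \<bar>w v\<bar> + ln \<bar>?c1\<bar> + ln \<bar>?c2\<bar>) = A * (2 * ln \<bar>?s\<bar>)" by (simp only:)
  then have "2 * A * ln \<bar>?s\<bar> - A * ln \<bar>?c1\<bar> - A * ln \<bar>?c2\<bar> = 2 * A * ln \<bar>w v\<bar>"
    unfolding distrib_left by linarith
  moreover have "v / D = h ?\<theta> + h ?\<eta>" unfolding v using D by simp
  then have "C * (v / D) = C * h ?\<theta> + C * h ?\<eta>" by (simp only: distrib_left)
  ultimately show "F ((x + y) / 2) + f 1 x + f 2 y
          = 2 * A * ln \<bar>w v\<bar> + C * (v / D) + (l\<^sub>0 + l 1 + l 2)"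
    unfolding Fm f1 f2 by (rule collect)
qed

section \<open>The families are regular\<close>

lemma C1_differentiable_onI:
  fixes f :: "real \<Rightarrow> real"
  assumes "\<And>x. x \<in> S \<Longrightarrow> (f has_real_derivative f' x) (at x)" "continuous_on S f'"
  shows "f C1_differentiable_on S"
  unfolding C1_differentiable_on_def has_real_derivative_iff_has_vector_derivative[symmetric]
  by (intro exI[of _ f'] conjI ballI assms)

lemma midpoint_in_interval:
  fixes I :: "real set"
  assumes "is_interval I" "x \<in> I" "y \<in> I"
  shows "(x + y) / 2 \<in> I"
  using assms mem_is_interval_1_I[of I x y "(x + y) / 2"] mem_is_interval_1_I[of I y x "(x + y) / 2"]
  by fastforce

text \<open>Needed because the derivative of \<open>G\<close> on \<open>g\<^sub>1(I) + g\<^sub>2(I)\<close> is two-sided.\<close>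

lemma nonzero_deriv_imp_open_image:
  fixes g :: "real \<Rightarrow> real"
  assumes I: "open I" "is_interval I"
    and der: "\<And>x. x \<in> I \<Longrightarrow> (g has_real_derivative g' x) (at x)" and nz: "\<And>x. x \<in> I \<Longrightarrow> g' x \<noteq> 0"
  shows "open (g ` I)"
proof (rule injective_into_1d_imp_open_map_UNIV[of I I])
  show "continuous_on I g" by (meson DERIV_isCont der continuous_at_imp_continuous_on)
  have "g x \<noteq> g y" if xy: "x \<in> I" "y \<in> I" "x < y" for x y
  proof
    assume "g x = g y"
    have sub: "{x..y} \<subseteq> I" by (auto intro: mem_is_interval_1_I[OF I(2) xy(1,2)])
    then have "continuous_on {x..y} g"
      using \<open>continuous_on I g\<close> continuous_on_subset by blast
    moreover have "(g has_derivative (*) (g' z)) (at z)" if "x < z" "z < y" for z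
    proof -
      have "z \<in> I" using sub that by auto
      from der[OF this] show ?thesis by (simp add: has_field_derivative_def)
    qed
    ultimately obtain z where "x < z" "z < y" "(*) (g' z) = (\<lambda>v. 0)"
      using Rolle_deriv[of x y g "\<lambda>z. (*) (g' z)"] \<open>g x = g y\<close> xy by blast
    then have "z \<in> I" "g' z * 1 = 0" using sub by (auto simp: fun_eq_iff)
    then show False using nz by auto
  qed
  then show "inj_on g I" unfolding inj_on_def by (metis linorder_neqE)
qed (use I in auto)

lemma DERIV_F_formula:
  assumes "sin (2 * \<alpha> * x + b) \<noteq> 0"
  shows "((\<lambda>x. 2 * A * ln \<bar>sin (2 * \<alpha> * x + b)\<bar> + 2 * B * x + m) has_real_derivative
      2 * A * (2 * \<alpha> * cos (2 * \<alpha> * x + b)) / sin (2 * \<alpha> * x + b) + 2 * B) (at x)"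
proof -
  have "((\<lambda>x. sin (2 * \<alpha> * x + b)) has_real_derivative 2 * \<alpha> * cos (2 * \<alpha> * x + b)) (at x)"
    by (auto intro!: derivative_eq_intros)
  note ln = DERIV_ln_abs[OF this assms]
  show ?thesis
    by (rule DERIV_cong[OF DERIV_add[OF DERIV_add[OF DERIV_cmult[OF ln, of "2 * A"]
        DERIV_cmult_Id[of "2 * B"]] DERIV_const]]) simp
qed

lemma DERIV_primitive_affine:
  assumes h: "reciprocal_primitive T h \<rho>" and nz: "cos (2 * \<alpha> * x + 2 * b) + T \<noteq> 0"
  shows "((\<lambda>x. h (\<alpha> * x + b)) has_real_derivative \<alpha> * \<rho> / (cos (2 * \<alpha> * x + 2 * b) + T)) (at x)"
proof -
  have e: "2 * (\<alpha> * x + b) = 2 * \<alpha> * x + 2 * b" by (simp add: algebra_simps)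
  have "(h has_real_derivative \<rho> / (cos (2 * \<alpha> * x + 2 * b) + T)) (at (\<alpha> * x + b))"
    using h nz unfolding reciprocal_primitive_def e[symmetric] by blast
  moreover have "((\<lambda>x. \<alpha> * x + b) has_real_derivative \<alpha>) (at x)"
    by (auto intro!: derivative_eq_intros)
  ultimately have "((\<lambda>x. h (\<alpha> * x + b)) has_real_derivative
      \<rho> / (cos (2 * \<alpha> * x + 2 * b) + T) * \<alpha>) (at x)"
    by (rule DERIV_chain2)
  then show ?thesis by (simp add: mult.commute)
qed

lemma DERIV_g_formula:
  assumes h: "reciprocal_primitive T h \<rho>" and nz: "cos (2 * \<alpha> * x + 2 * b) + T \<noteq> 0"
  shows "((\<lambda>x. D * h (\<alpha> * x + b) + m) has_real_derivative
      D * (\<alpha> * \<rho> / (cos (2 * \<alpha> * x + 2 * b) + T))) (at x)"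
  by (rule DERIV_cong[OF DERIV_add[OF DERIV_cmult[OF DERIV_primitive_affine[OF h nz], of D] DERIV_const]]) simp

lemma DERIV_f_formula:
  assumes h: "reciprocal_primitive T h \<rho>" and nz: "cos (2 * \<alpha> * x + 2 * b) + T \<noteq> 0"
  shows "((\<lambda>x. - A * ln \<bar>cos (2 * \<alpha> * x + 2 * b) + T\<bar> - B * x + C * h (\<alpha> * x + b) + m)
     has_real_derivative
      A * (2 * \<alpha> * sin (2 * \<alpha> * x + 2 * b)) / (cos (2 * \<alpha> * x + 2 * b) + T) - B
       + C * (\<alpha> * \<rho> / (cos (2 * \<alpha> * x + 2 * b) + T))) (at x)"
proof -
  have "((\<lambda>x. cos (2 * \<alpha> * x + 2 * b) + T) has_real_derivative
      - (2 * \<alpha> * sin (2 * \<alpha> * x + 2 * b))) (at x)"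
    by (auto intro!: derivative_eq_intros)
  note ln = DERIV_ln_abs[OF this nz]
  show ?thesis
    by (rule DERIV_cong[OF DERIV_add[OF DERIV_add[OF DERIV_diff[OF DERIV_cmult[OF ln, of "- A"]
      DERIV_cmult_Id[of B]] DERIV_cmult[OF DERIV_primitive_affine[OF h nz], of C]] DERIV_const]]) simp
qed

lemma family_is_regular_solution:
  assumes I: "open I" "is_interval I"
    and AD: "A * D \<noteq> 0" and \<alpha>: "\<alpha> \<noteq> 0" and \<beta>: "\<beta> 1 + \<beta> 2 = of_int n * pi + \<beta>\<^sub>0"
    and F: "F_form I F A B \<alpha> \<beta>\<^sub>0 l\<^sub>0" and fg: "fg_form I h f g A B C D T \<alpha> \<beta> l \<mu>"
    and G: "G_form (g 1 ` I + g 2 ` I) w G A C D (\<mu> 1 + \<mu> 2) (l\<^sub>0 + l 1 + l 2)"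
    and h: "reciprocal_primitive T h \<rho>"
    and add: "\<And>x y. x \<in> I \<Longrightarrow> y \<in> I \<Longrightarrow> addition_law T h w D (\<alpha> * x + \<beta> 1) (\<alpha> * y + \<beta> 2)"
    and w: "\<And>v. (w has_real_derivative w' v) (at v)" "continuous_on UNIV w'"
  shows "regular_solution I F f G g"
proof -
  have D: "D \<noteq> 0" using AD by auto
  have \<rho>: "\<rho> \<noteq> 0" using h by (simp add: reciprocal_primitive_def)
  have nz: "cos (2 * \<alpha> * x + 2 * \<beta> k) + T \<noteq> 0"
    and fk: "f k x = - A * ln \<bar>cos (2 * \<alpha> * x + 2 * \<beta> k) + T\<bar> - B * x + C * h (\<alpha> * x + \<beta> k) + l k"
    and gk: "g k x = D * h (\<alpha> * x + \<beta> k) + \<mu> k" if "x \<in> I" "k \<in> {1, 2}" for x k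
    using fg that unfolding fg_form_def by blast+
  have gder: "(g k has_real_derivative D * (\<alpha> * \<rho> / (cos (2 * \<alpha> * x + 2 * \<beta> k) + T))) (at x)"
    if "x \<in> I" "k \<in> {1, 2}" for x k
  proof (rule has_field_derivative_transform_within_open[OF _ I(1) \<open>x \<in> I\<close>])
    show "((\<lambda>x. D * h (\<alpha> * x + \<beta> k) + \<mu> k) has_real_derivative
        D * (\<alpha> * \<rho> / (cos (2 * \<alpha> * x + 2 * \<beta> k) + T))) (at x)"
      by (rule DERIV_g_formula[OF h nz[OF that]])
  qed (use gk that in auto)
  have fder: "(f k has_real_derivative
      A * (2 * \<alpha> * sin (2 * \<alpha> * x + 2 * \<beta> k)) / (cos (2 * \<alpha> * x + 2 * \<beta> k) + T) - B
       + C * (\<alpha> * \<rho> / (cos (2 * \<alpha> * x + 2 * \<beta> k) + T))) (at x)"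
    if "x \<in> I" "k \<in> {1, 2}" for x k
  proof (rule has_field_derivative_transform_within_open[OF _ I(1) \<open>x \<in> I\<close>])
    show "((\<lambda>x. - A * ln \<bar>cos (2 * \<alpha> * x + 2 * \<beta> k) + T\<bar> - B * x + C * h (\<alpha> * x + \<beta> k) + l k)
       has_real_derivative
      A * (2 * \<alpha> * sin (2 * \<alpha> * x + 2 * \<beta> k)) / (cos (2 * \<alpha> * x + 2 * \<beta> k) + T) - B
       + C * (\<alpha> * \<rho> / (cos (2 * \<alpha> * x + 2 * \<beta> k) + T))) (at x)"
      by (rule DERIV_f_formula[OF h nz[OF that]])
  qed (use fk that in auto)
  have cont: "continuous_on I (\<lambda>x. c / (cos (2 * \<alpha> * x + 2 * \<beta> k) + T))" if "k \<in> {1, 2}" for k and c :: real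
    by (intro continuous_intros ballI) (rule nz[OF _ that])
  have gC1: "g k C1_differentiable_on I" if "k \<in> {1, 2}" for k
  proof (rule C1_differentiable_onI[OF gder[OF _ that]])
    show "continuous_on I (\<lambda>x. D * (\<alpha> * \<rho> / (cos (2 * \<alpha> * x + 2 * \<beta> k) + T)))"
      by (intro continuous_on_mult continuous_on_const cont that)
  qed
  have fC1: "f k C1_differentiable_on I" if "k \<in> {1, 2}" for k
  proof (rule C1_differentiable_onI[OF fder[OF _ that]])
    show "continuous_on I (\<lambda>x. A * (2 * \<alpha> * sin (2 * \<alpha> * x + 2 * \<beta> k)) /
        (cos (2 * \<alpha> * x + 2 * \<beta> k) + T) - B + C * (\<alpha> * \<rho> / (cos (2 * \<alpha> * x + 2 * \<beta> k) + T)))"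
      by (intro continuous_intros ballI nz that)
  qed
  have s: "sin (2 * \<alpha> * x + \<beta>\<^sub>0) \<noteq> 0" and Fx: "F x = 2 * A * ln \<bar>sin (2 * \<alpha> * x + \<beta>\<^sub>0)\<bar> + 2 * B * x + l\<^sub>0"
    if "x \<in> I" for x using F that unfolding F_form_def by blast+
  have Fder: "(F has_real_derivative
      2 * A * (2 * \<alpha> * cos (2 * \<alpha> * x + \<beta>\<^sub>0)) / sin (2 * \<alpha> * x + \<beta>\<^sub>0) + 2 * B) (at x)" if "x \<in> I" for x
  proof (rule has_field_derivative_transform_within_open[OF _ I(1) \<open>x \<in> I\<close>])
    show "((\<lambda>x. 2 * A * ln \<bar>sin (2 * \<alpha> * x + \<beta>\<^sub>0)\<bar> + 2 * B * x + l\<^sub>0) has_real_derivative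
      2 * A * (2 * \<alpha> * cos (2 * \<alpha> * x + \<beta>\<^sub>0)) / sin (2 * \<alpha> * x + \<beta>\<^sub>0) + 2 * B) (at x)"
      by (rule DERIV_F_formula[OF s[OF that]])
  qed (use Fx in auto)
  have FC1: "F C1_differentiable_on I"
  proof (rule C1_differentiable_onI[OF Fder])
    show "continuous_on I (\<lambda>x. 2 * A * (2 * \<alpha> * cos (2 * \<alpha> * x + \<beta>\<^sub>0)) / sin (2 * \<alpha> * x + \<beta>\<^sub>0) + 2 * B)"
      by (intro continuous_intros ballI s)
  qed
  let ?U = "g 1 ` I + g 2 ` I" and ?m = "\<mu> 1 + \<mu> 2"
  have gnz: "D * (\<alpha> * \<rho> / (cos (2 * \<alpha> * x + 2 * \<beta> k) + T)) \<noteq> 0" if "x \<in> I" "k \<in> {1, 2}" for x k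
    using nz[OF that] D \<alpha> \<rho> by simp
  have "open (g 1 ` I)"
    using nonzero_deriv_imp_open_image[OF I gder[of _ 1] gnz[of _ 1]] by auto
  then have "open (\<Union>x\<in>g 1 ` I. \<Union>y\<in>g 2 ` I. {x + y})" by (intro open_sums) auto
  moreover have "(\<Union>x\<in>g 1 ` I. \<Union>y\<in>g 2 ` I. {x + y}) = ?U" by (auto simp: set_plus_def)
  ultimately have Uopen: "open ?U" by simp
  have wnz: "w (u - ?m) \<noteq> 0"
    and Gu: "G u = 2 * A * ln \<bar>w (u - ?m)\<bar> + C * ((u - ?m) / D) + (l\<^sub>0 + l 1 + l 2)" if "u \<in> ?U" for u
    using G that unfolding G_form_def by blast+
  have Gder: "(G has_real_derivative 2 * A * w' (u - ?m) / w (u - ?m) + C / D) (at u)" if "u \<in> ?U" for u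
  proof (rule has_field_derivative_transform_within_open[OF _ Uopen that])
    have "((\<lambda>u. w (u - ?m)) has_real_derivative w' (u - ?m) * 1) (at u)"
      by (rule DERIV_chain2[OF w(1)]) (auto intro!: derivative_eq_intros)
    then have "((\<lambda>u. w (u - ?m)) has_real_derivative w' (u - ?m)) (at u)" by simp
    note ln = DERIV_ln_abs[OF this wnz[OF that]]
    have lin: "((\<lambda>u. C * ((u - ?m) / D)) has_real_derivative C / D) (at u)"
      using D by (auto intro!: derivative_eq_intros)
    show "((\<lambda>u. 2 * A * ln \<bar>w (u - ?m)\<bar> + C * ((u - ?m) / D) + (l\<^sub>0 + l 1 + l 2)) has_real_derivative
        2 * A * w' (u - ?m) / w (u - ?m) + C / D) (at u)"
      by (rule DERIV_cong[OF DERIV_add[OF DERIV_add[OF DERIV_cmult[OF ln, of "2 * A"] lin] DERIV_const]]) simp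
  qed (use Gu in auto)
  have wcont: "continuous_on UNIV w" by (meson DERIV_isCont w(1) continuous_at_imp_continuous_on)
  have shift: "continuous_on ?U (\<lambda>u. u - ?m)" by (intro continuous_intros)
  note comp = continuous_on_compose2[OF wcont shift subset_UNIV] continuous_on_compose2[OF w(2) shift subset_UNIV]
  have GC1: "G C1_differentiable_on ?U"
  proof (rule C1_differentiable_onI[OF Gder])
    show "continuous_on ?U (\<lambda>u. 2 * A * w' (u - ?m) / w (u - ?m) + C / D)"
      by (intro continuous_on_add continuous_on_divide continuous_on_mult
        continuous_on_const comp ballI wnz D)
  qed
  have dg: "deriv (g k) x \<noteq> 0" if "x \<in> I" "k \<in> {1, 2}" for x k
    using DERIV_imp_deriv[OF gder[OF that]] gnz[OF that] by simp
  have "regular I F f G g"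
    unfolding regular_def
  proof (intro conjI ballI)
    have "deriv (g 1) x \<noteq> 0" "deriv (g 2) x \<noteq> 0" if "x \<in> I" for x
      by (rule dg[OF that], simp)+
    then show "0 \<notin> deriv (g 1) ` I \<union> deriv (g 2) ` I" by (auto simp: image_iff)
  qed (rule FC1 fC1 gC1 GC1; assumption)+
  moreover have "solves_E I F f G g"
    unfolding solves_E_def
  proof (intro ballI)
    fix x y assume xy: "x \<in> I" "y \<in> I"
    note m = midpoint_in_interval[OF I(2) xy]
    have U: "g 1 x + g 2 y \<in> ?U" using xy by (auto simp: set_plus_def)
    from family_satisfies_E(2)[OF F fg \<beta> D add[OF xy] xy m] Gu[OF U, symmetric]
    show "F ((x + y) / 2) + f 1 x + f 2 y = G (g 1 x + g 2 y)" by (rule trans)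
  qed
  ultimately show ?thesis by (simp add: regular_solution_def)
qed

lemma nonvanishing_same_sign:
  fixes c :: "real \<Rightarrow> real"
  assumes I: "is_interval I" and c: "continuous_on I c" "\<And>x. x \<in> I \<Longrightarrow> c x \<noteq> 0" and x: "x \<in> I" and y: "y \<in> I"
  shows "c x * c y > 0"
proof (rule ccontr)
  assume "\<not> c x * c y > 0"
  with c(2)[OF x] c(2)[OF y] have "c x < 0 \<and> 0 < c y \<or> c y < 0 \<and> 0 < c x"
    by (auto simp: zero_less_mult_iff not_less order_le_less)
  moreover have "is_interval (c ` I)"
    using connected_continuous_image[OF c(1)] I by (simp add: is_interval_connected_1)
  ultimately have "0 \<in> c ` I"
    using x y mem_is_interval_1_I[of "c ` I" "c x" "c y" 0] mem_is_interval_1_I[of "c ` I" "c y" "c x" 0]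
    by auto
  then show False using c(2) by force
qed

lemma fg_form_nonzero:
  assumes "fg_form I h f g A B C D T \<alpha> \<beta> l \<mu>" "k \<in> {1, 2}" "x \<in> I"
  shows "cos (2 * (\<alpha> * x + \<beta> k)) + T \<noteq> 0"
proof -
  have "2 * (\<alpha> * x + \<beta> k) = 2 * \<alpha> * x + 2 * \<beta> k" by (simp add: algebra_simps)
  then show ?thesis using assms unfolding fg_form_def by metis
qed

lemma fg_form_same_sign:
  assumes "is_interval I" "fg_form I h f g A B C D T \<alpha> \<beta> l \<mu>" "k \<in> {1, 2}" "x \<in> I" "y \<in> I"
  shows "(cos (2 * \<alpha> * x + 2 * \<beta> k) + T) * (cos (2 * \<alpha> * y + 2 * \<beta> k) + T) > 0"
proof (rule nonvanishing_same_sign[OF assms(1) _ _ assms(4,5)])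
  show "cos (2 * \<alpha> * x + 2 * \<beta> k) + T \<noteq> 0" if "x \<in> I" for x
    using assms(2,3) that unfolding fg_form_def by blast
qed (intro continuous_intros)

lemma solution_family_is_regular_solution:
  assumes I: "open I" "is_interval I"
    and fam: "solution_family I F f G g A B C D T \<alpha> \<beta>\<^sub>0 \<beta> l\<^sub>0 l \<mu>"
  shows "regular_solution I F f G g"
proof -
  obtain n :: int where common: "A * D \<noteq> 0" "\<alpha> \<noteq> 0" "\<beta> 1 + \<beta> 2 = of_int n * pi + \<beta>\<^sub>0"
    "F_form I F A B \<alpha> \<beta>\<^sub>0 l\<^sub>0"
    using fam unfolding solution_family_def by blast
  then have D: "D \<noteq> 0" by auto
  have e: "2 * (\<alpha> * x + \<beta> k) = 2 * \<alpha> * x + 2 * \<beta> k" for x k by (simp add: algebra_simps)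
  note main = family_is_regular_solution[OF I common]
  consider "T1_sinh I f G g A B C D T \<alpha> \<beta> l\<^sub>0 l \<mu>" | "T1_cosh I f G g A B C D T \<alpha> \<beta> l\<^sub>0 l \<mu>"
    | "T2 I f G g A B C D T \<alpha> \<beta> l\<^sub>0 l \<mu>" | "T3 I f G g A B C D T \<alpha> \<beta> l\<^sub>0 l \<mu>"
    using fam unfolding solution_family_def by blast
  then show ?thesis
  proof cases
    case 1
    then have T: "T\<^sup>2 < 1" and fg: "fg_form I (ln_tan (tau T)) f g A B C D T \<alpha> \<beta> l \<mu>"
      and sgn: "\<And>x. x \<in> I \<Longrightarrow> (cos (2 * \<alpha> * x + 2 * \<beta> 1) + T) * (cos (2 * \<alpha> * x + 2 * \<beta> 2) + T) > 0"
      and G: "G_form (g 1 ` I + g 2 ` I) (\<lambda>v. T_star T * sinh (v / (2 * D))) G A C D (\<mu> 1 + \<mu> 2) (l\<^sub>0 + l 1 + l 2)"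
      unfolding T1_sinh_def by blast+
    show ?thesis
    proof (rule main[OF fg G ln_tan_primitive[OF T] addition_law_sinh[OF T _ D]])
      show "(cos (2 * (\<alpha> * x + \<beta> 1)) + T) * (cos (2 * (\<alpha> * y + \<beta> 2)) + T) > 0" if "x \<in> I" "y \<in> I" for x y
        using sgn[OF that(1)] fg_form_same_sign[OF I(2) fg _ that, of 2] unfolding e
        by (auto simp: zero_less_mult_iff mult_less_0_iff)
      show "((\<lambda>v. T_star T * sinh (v / (2 * D))) has_real_derivative T_star T * (cosh (v / (2 * D)) / (2 * D))) (at v)" for v
        using D by (auto intro!: derivative_eq_intros)
      show "continuous_on UNIV (\<lambda>v. T_star T * (cosh (v / (2 * D)) / (2 * D)))"
        using D by (auto intro!: continuous_intros)
    qed
  next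
    case 2
    then have T: "T\<^sup>2 < 1" and fg: "fg_form I (ln_tan (tau T)) f g A B C D T \<alpha> \<beta> l \<mu>"
      and sgn: "\<And>x. x \<in> I \<Longrightarrow> (cos (2 * \<alpha> * x + 2 * \<beta> 1) + T) * (cos (2 * \<alpha> * x + 2 * \<beta> 2) + T) < 0"
      and G: "G_form (g 1 ` I + g 2 ` I) (\<lambda>v. T_star T * cosh (v / (2 * D))) G A C D (\<mu> 1 + \<mu> 2) (l\<^sub>0 + l 1 + l 2)"
      unfolding T1_cosh_def by blast+
    show ?thesis
    proof (rule main[OF fg G ln_tan_primitive[OF T] addition_law_cosh[OF T _ D]])
      show "(cos (2 * (\<alpha> * x + \<beta> 1)) + T) * (cos (2 * (\<alpha> * y + \<beta> 2)) + T) < 0" if "x \<in> I" "y \<in> I" for x y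
        using sgn[OF that(1)] fg_form_same_sign[OF I(2) fg _ that, of 2] unfolding e
        by (auto simp: zero_less_mult_iff mult_less_0_iff)
      show "((\<lambda>v. T_star T * cosh (v / (2 * D))) has_real_derivative T_star T * (sinh (v / (2 * D)) / (2 * D))) (at v)" for v
        using D by (auto intro!: derivative_eq_intros)
      show "continuous_on UNIV (\<lambda>v. T_star T * (sinh (v / (2 * D)) / (2 * D)))"
        using D by (auto intro!: continuous_intros)
    qed
  next
    case 3
    then have T: "T\<^sup>2 = 1" and fg: "fg_form I (tan_pow T) f g A B C D T \<alpha> \<beta> l \<mu>"
      and G: "G_form (g 1 ` I + g 2 ` I) (\<lambda>v. v / (2 * D)) G A C D (\<mu> 1 + \<mu> 2) (l\<^sub>0 + l 1 + l 2)"
      unfolding T2_def by blast+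
    show ?thesis
    proof (rule main[OF fg G tan_pow_primitive[OF T] addition_law_tan_pow[OF T _ _ D]])
      show "((\<lambda>v. v / (2 * D)) has_real_derivative 1 / (2 * D)) (at v)" for v
        using D by (auto intro!: derivative_eq_intros)
      show "cos (2 * (\<alpha> * x + \<beta> 1)) + T \<noteq> 0" "cos (2 * (\<alpha> * x + \<beta> 2)) + T \<noteq> 0" if "x \<in> I" for x
        using fg_form_nonzero[OF fg _ that] by blast+
    qed auto
  next
    case 4
    then have T: "T\<^sup>2 > 1" and fg: "fg_form I (arctan_tan (tau T)) f g A B C D T \<alpha> \<beta> l \<mu>"
      and G: "G_form (g 1 ` I + g 2 ` I) (\<lambda>v. T_star T * sin (v / D)) G A C D (\<mu> 1 + \<mu> 2) (l\<^sub>0 + l 1 + l 2)"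
      unfolding T3_def by blast+
    show ?thesis
    proof (rule main[OF fg G arctan_tan_primitive[OF T] addition_law_arctan_tan[OF T _ _ D]])
      show "((\<lambda>v. T_star T * sin (v / D)) has_real_derivative T_star T * (cos (v / D) / D)) (at v)" for v
        using D by (auto intro!: derivative_eq_intros)
      show "continuous_on UNIV (\<lambda>v. T_star T * (cos (v / D) / D))"
        using D by (auto intro!: continuous_intros)
      show "cos (2 * (\<alpha> * x + \<beta> 1)) + T \<noteq> 0" "cos (2 * (\<alpha> * x + \<beta> 2)) + T \<noteq> 0" if "x \<in> I" for x
        using fg_form_nonzero[OF fg _ that] by blast+
    qed
  qed
qed

section \<open>Determination of the derivatives\<close>

text \<open>Separation of variables: if a function of \<open>(x, y)\<close> is, for fixed \<open>x\<close>, a combination of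
  \<open>cos (q y)\<close> and \<open>sin (q y)\<close>, and for fixed \<open>y\<close> one of \<open>cos (p x)\<close> and \<open>sin (p x)\<close>, then it is a bilinear
  form in these pairs. The sine hypotheses say that each pair is linearly independent on two points.\<close>

lemma trig_separation:
  fixes p q :: "real \<Rightarrow> real"
  assumes eq: "\<And>x y. x \<in> I \<Longrightarrow> y \<in> I \<Longrightarrow>
      X1 x * cos (q y) - Y1 x * sin (q y) = X2 y * cos (p x) - Y2 y * sin (p x)"
    and x: "x0 \<in> I" "x1 \<in> I" "sin (p x1 - p x0) \<noteq> 0"
    and y: "y0 \<in> I" "y1 \<in> I" "sin (q y1 - q y0) \<noteq> 0"
  obtains m11 m12 m21 m22 where
    "\<And>x. x \<in> I \<Longrightarrow> X1 x = m11 * cos (p x) - m12 * sin (p x)"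
    "\<And>x. x \<in> I \<Longrightarrow> Y1 x = m21 * cos (p x) - m22 * sin (p x)"
    "\<And>y. y \<in> I \<Longrightarrow> X2 y = m11 * cos (q y) - m21 * sin (q y)"
    "\<And>y. y \<in> I \<Longrightarrow> Y2 y = m12 * cos (q y) - m22 * sin (q y)"
proof
  define d where "d = sin (q y1) * cos (q y0) - cos (q y1) * sin (q y0)"
  have d: "d \<noteq> 0" using y(3) by (simp add: d_def sin_diff)
  have solve: "a = u / d * c - v / d * s" if "a * d = u * c - v * s" for a u v c s
    using d that by (simp add: field_simps)
  \<comment> \<open>The coefficients solve the linear system given by \<open>y0\<close> and \<open>y1\<close>.\<close>
  let ?m11 = "(X2 y0 * sin (q y1) - X2 y1 * sin (q y0)) / d"
  let ?m12 = "(Y2 y0 * sin (q y1) - Y2 y1 * sin (q y0)) / d"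
  let ?m21 = "(X2 y0 * cos (q y1) - X2 y1 * cos (q y0)) / d"
  let ?m22 = "(Y2 y0 * cos (q y1) - Y2 y1 * cos (q y0)) / d"
  show X1: "X1 x = ?m11 * cos (p x) - ?m12 * sin (p x)" if "x \<in> I" for x
  proof -
    have "X1 x * d = (X2 y0 * sin (q y1) - X2 y1 * sin (q y0)) * cos (p x)
        - (Y2 y0 * sin (q y1) - Y2 y1 * sin (q y0)) * sin (p x)"
      using eq[OF that y(1)] eq[OF that y(2)] unfolding d_def by algebra
    then show ?thesis by (rule solve)
  qed
  show Y1: "Y1 x = ?m21 * cos (p x) - ?m22 * sin (p x)" if "x \<in> I" for x
  proof -
    have "Y1 x * d = (X2 y0 * cos (q y1) - X2 y1 * cos (q y0)) * cos (p x)
        - (Y2 y0 * cos (q y1) - Y2 y1 * cos (q y0)) * sin (p x)"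
      using eq[OF that y(1)] eq[OF that y(2)] unfolding d_def by algebra
    then show ?thesis by (rule solve)
  qed
  define m11 where m11: "m11 = ?m11"
  define m12 where m12: "m12 = ?m12"
  define m21 where m21: "m21 = ?m21"
  define m22 where m22: "m22 = ?m22"
  note m = m11 m12 m21 m22
  have key: "X2 y = m11 * cos (q y) - m21 * sin (q y) \<and> Y2 y = m12 * cos (q y) - m22 * sin (q y)"
    if "y \<in> I" for y
  proof -
    define u where "u = X2 y - (m11 * cos (q y) - m21 * sin (q y))"
    define v where "v = Y2 y - (m12 * cos (q y) - m22 * sin (q y))"
    have z: "u * cos (p x) = v * sin (p x)" if "x \<in> I" for x
      using eq[OF that \<open>y \<in> I\<close>] X1[OF that, folded m] Y1[OF that, folded m] unfolding u_def v_def by algebra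
    have "sin (p x1) * cos (p x0) - cos (p x1) * sin (p x0) \<noteq> 0"
      using x(3) by (simp add: sin_diff)
    moreover have "u * (sin (p x1) * cos (p x0) - cos (p x1) * sin (p x0)) = 0"
      "v * (sin (p x1) * cos (p x0) - cos (p x1) * sin (p x0)) = 0"
      using z[OF x(1)] z[OF x(2)] by algebra+
    ultimately show ?thesis by (simp add: u_def v_def)
  qed
  show "X2 y = ?m11 * cos (q y) - ?m21 * sin (q y)" if "y \<in> I" for y
    using key[OF that] unfolding m by (rule conjunct1)
  show "Y2 y = ?m12 * cos (q y) - ?m22 * sin (q y)" if "y \<in> I" for y
    using key[OF that] unfolding m by (rule conjunct2)
qed

lemma C1_differentiable_on_DERIV:
  fixes f :: "real \<Rightarrow> real"
  assumes "f C1_differentiable_on S" "x \<in> S"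
  shows "(f has_real_derivative deriv f x) (at x)"
  using assms DERIV_imp_deriv
  unfolding C1_differentiable_on_def has_real_derivative_iff_has_vector_derivative[symmetric] by metis

lemma regular_solution_DERIV:
  assumes "regular_solution I F f G g"
  shows "x \<in> I \<Longrightarrow> (F has_real_derivative deriv F x) (at x)"
    and "x \<in> I \<Longrightarrow> k \<in> {1, 2} \<Longrightarrow> (f k has_real_derivative deriv (f k) x) (at x)"
    and "x \<in> I \<Longrightarrow> k \<in> {1, 2} \<Longrightarrow> (g k has_real_derivative deriv (g k) x) (at x)"
    and "x \<in> I \<Longrightarrow> k \<in> {1, 2} \<Longrightarrow> deriv (g k) x \<noteq> 0"
    and "u \<in> g 1 ` I + g 2 ` I \<Longrightarrow> (G has_real_derivative deriv G u) (at u)"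
proof -
  have r: "F C1_differentiable_on I" "\<And>k. k \<in> {1, 2} \<Longrightarrow> f k C1_differentiable_on I"
    "\<And>k. k \<in> {1, 2} \<Longrightarrow> g k C1_differentiable_on I" "G C1_differentiable_on (g 1 ` I + g 2 ` I)"
    "0 \<notin> deriv (g 1) ` I \<union> deriv (g 2) ` I"
    using assms unfolding regular_solution_def regular_def by blast+
  show "x \<in> I \<Longrightarrow> (F has_real_derivative deriv F x) (at x)" by (rule C1_differentiable_on_DERIV[OF r(1)])
  show "(f k has_real_derivative deriv (f k) x) (at x)" "(g k has_real_derivative deriv (g k) x) (at x)"
    if "x \<in> I" "k \<in> {1, 2}" using C1_differentiable_on_DERIV r(2,3) that by blast+
  show "deriv (g k) x \<noteq> 0" if "x \<in> I" "k \<in> {1, 2}"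
    using r(5) that by (metis UnCI imageI insertE singletonD)
  show "u \<in> g 1 ` I + g 2 ` I \<Longrightarrow> (G has_real_derivative deriv G u) (at u)"
    by (rule C1_differentiable_on_DERIV[OF r(4)])
qed

text \<open>Differentiating the equation with respect to each variable and eliminating the derivative of \<open>G\<close>.\<close>

lemma regular_solution_functional_equation:
  assumes I: "open I" "is_interval I" and sol: "regular_solution I F f G g"
    and x: "x \<in> I" and y: "y \<in> I"
  shows "\<phi> F ((x + y) / 2) * (1 / deriv (g 1) x - 1 / deriv (g 2) y)
       = deriv (f 2) y / deriv (g 2) y - deriv (f 1) x / deriv (g 1) x"
proof -
  note der = regular_solution_DERIV[OF sol]
  have eq: "F ((s + t) / 2) + f 1 s + f 2 t = G (g 1 s + g 2 t)" if "s \<in> I" "t \<in> I" for s t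
    using sol that unfolding regular_solution_def solves_E_def by blast
  let ?m = "(x + y) / 2" and ?u = "g 1 x + g 2 y"
  have m: "?m \<in> I" by (rule midpoint_in_interval[OF I(2) x y])
  have u: "?u \<in> g 1 ` I + g 2 ` I" using x y by (auto simp: set_plus_def)
  have k: "(1::nat) \<in> {1, 2}" "(2::nat) \<in> {1, 2}" by simp_all
  have half: "((\<lambda>s. (s + y) / 2) has_real_derivative 1/2) (at x)"
    "((\<lambda>t. (x + t) / 2) has_real_derivative 1/2) (at y)"
    by (auto intro!: derivative_eq_intros)
  have ux: "((\<lambda>s. g 1 s + g 2 y) has_real_derivative deriv (g 1) x) (at x)"
    using DERIV_add[OF der(3)[OF x k(1)] DERIV_const[of "g 2 y"]] by simp
  have uy: "((\<lambda>t. g 1 x + g 2 t) has_real_derivative deriv (g 2) y) (at y)"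
    using DERIV_add[OF DERIV_const[of "g 1 x"] der(3)[OF y k(2)]] by simp
  have 1: "((\<lambda>s. F ((s + y) / 2) + f 1 s + f 2 y) has_real_derivative
      deriv F ?m * (1/2) + deriv (f 1) x + 0) (at x)"
    by (intro DERIV_add DERIV_const der(2)[OF x k(1)] DERIV_chain2[OF der(1)[OF m] half(1)])
  have "((\<lambda>s. F ((s + y) / 2) + f 1 s + f 2 y) has_real_derivative deriv G ?u * deriv (g 1) x) (at x)"
    by (rule has_field_derivative_transform_within_open[OF DERIV_chain2[OF der(5)[OF u] ux] I(1) x])
      (rule eq[OF _ y, symmetric])
  from DERIV_unique[OF 1 this] have ex: "\<phi> F ?m + deriv (f 1) x = deriv G ?u * deriv (g 1) x"
    by (simp add: \<phi>_def)
  have 2: "((\<lambda>t. F ((x + t) / 2) + f 1 x + f 2 t) has_real_derivative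
      deriv F ?m * (1/2) + 0 + deriv (f 2) y) (at y)"
    by (intro DERIV_add DERIV_const der(2)[OF y k(2)] DERIV_chain2[OF der(1)[OF m] half(2)])
  have "((\<lambda>t. F ((x + t) / 2) + f 1 x + f 2 t) has_real_derivative deriv G ?u * deriv (g 2) y) (at y)"
    by (rule has_field_derivative_transform_within_open[OF DERIV_chain2[OF der(5)[OF u] uy] I(1) y])
      (rule eq[OF x, symmetric])
  from DERIV_unique[OF 2 this] have ey: "\<phi> F ?m + deriv (f 2) y = deriv G ?u * deriv (g 2) y"
    by (simp add: \<phi>_def)
  have "(\<phi> F ?m + deriv (f 1) x) / deriv (g 1) x = (\<phi> F ?m + deriv (f 2) y) / deriv (g 2) y"
    unfolding ex ey using der(4)[OF x k(1)] der(4)[OF y k(2)] by simp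
  then show ?thesis by (simp add: add_divide_distrib right_diff_distrib)
qed

text \<open>A trigonometric fraction is an affine function of a shifted cotangent. The frequency is written
  \<open>2 * \<alpha>\<close>, so that at a midpoint \<open>(x + y) / 2\<close> the angle becomes \<open>\<alpha> * x + \<alpha> * y + \<delta>\<close>.\<close>

lemma trig_fraction_cot:
  assumes "trig_fraction_on \<phi>' I"
  obtains A0 B0 \<alpha> \<delta> where "A0 \<noteq> 0" "\<alpha> > 0"
    "\<And>x. x \<in> I \<Longrightarrow> sin (2 * \<alpha> * x + \<delta>) \<noteq> 0"
    "\<And>x. x \<in> I \<Longrightarrow> \<phi>' x = B0 + A0 * (cos (2 * \<alpha> * x + \<delta>) / sin (2 * \<alpha> * x + \<delta>))"
proof -
  obtain a b c d \<kappa> where ad: "a * d \<noteq> b * c" and \<kappa>: "\<kappa> > 0"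
    and nz: "\<And>x. x \<in> I \<Longrightarrow> a * sin (\<kappa> * x) + b * cos (\<kappa> * x) \<noteq> 0"
    and \<phi>': "\<And>x. x \<in> I \<Longrightarrow> \<phi>' x = (c * sin (\<kappa> * x) + d * cos (\<kappa> * x)) / (a * sin (\<kappa> * x) + b * cos (\<kappa> * x))"
    using assms unfolding trig_fraction_on_def by blast
  obtain r \<delta> where ab: "a = r * cos \<delta>" "b = r * sin \<delta>" using polar_Ex by blast
  have r: "r \<noteq> 0" using ad ab by auto
  define A0 where "A0 = (d * cos \<delta> - c * sin \<delta>) / r"
  define B0 where "B0 = (c * cos \<delta> + d * sin \<delta>) / r"
  have cd: "c = r * (B0 * cos \<delta> - A0 * sin \<delta>)" "d = r * (B0 * sin \<delta> + A0 * cos \<delta>)"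
  proof -
    have rA: "r * A0 = d * cos \<delta> - c * sin \<delta>" "r * B0 = c * cos \<delta> + d * sin \<delta>"
      using r by (simp_all add: A0_def B0_def)
    have "r * (B0 * cos \<delta> - A0 * sin \<delta>) = c * ((sin \<delta>)\<^sup>2 + (cos \<delta>)\<^sup>2)"
      "r * (B0 * sin \<delta> + A0 * cos \<delta>) = d * ((sin \<delta>)\<^sup>2 + (cos \<delta>)\<^sup>2)"
      using rA by algebra+
    then show "c = r * (B0 * cos \<delta> - A0 * sin \<delta>)" "d = r * (B0 * sin \<delta> + A0 * cos \<delta>)" by simp_all
  qed
  have "A0 \<noteq> 0" using ad r unfolding A0_def ab by (auto simp: algebra_simps)
  moreover have "\<kappa> / 2 > 0" using \<kappa> by simp
  moreover have den: "a * sin (\<kappa> * x) + b * cos (\<kappa> * x) = r * sin (\<kappa> * x + \<delta>)" for x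
    by (simp add: ab sin_add algebra_simps)
  have num: "c * sin (\<kappa> * x) + d * cos (\<kappa> * x) = r * (B0 * sin (\<kappa> * x + \<delta>) + A0 * cos (\<kappa> * x + \<delta>))" for x
    unfolding cd by (simp add: sin_add cos_add algebra_simps)
  have snz: "sin (2 * (\<kappa> / 2) * x + \<delta>) \<noteq> 0" if "x \<in> I" for x using nz[OF that] by (simp add: den)
  moreover have "\<phi>' x = B0 + A0 * (cos (2 * (\<kappa> / 2) * x + \<delta>) / sin (2 * (\<kappa> / 2) * x + \<delta>))" if "x \<in> I" for x
    using snz[OF that] r unfolding \<phi>'[OF that] num den by (simp add: add_divide_distrib)
  ultimately show thesis by (rule that)
qed

text \<open>Either condition on \<open>\<psi>\<close> rules out that \<open>g\<^sub>1'\<close> and \<open>g\<^sub>2'\<close> are the same constant: otherwise \<open>\<psi>\<^sub>1 = 0\<close>,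
  and \<open>\<psi>\<^sub>2\<close> is constant although its derivative is a nonzero multiple of the nonvanishing denominator of \<open>\<phi>\<close>.\<close>

lemma psi_conditions_exclude_constant:
  assumes I: "open I" "I \<noteq> {}" and psi: "psi1_condition I F g \<or> psi2_condition I F f g"
    and const: "\<And>x. x \<in> I \<Longrightarrow> 1 / deriv (g 1) x = E" "\<And>x. x \<in> I \<Longrightarrow> 1 / deriv (g 2) x = E"
  shows False
  using psi
proof
  assume "psi1_condition I F g"
  then obtain a b \<gamma> where h: "\<And>x. x \<in> I \<Longrightarrow> \<psi> g 1 x = a * S_fun \<gamma> x + b * C_fun \<gamma> x"
    "\<And>x. x \<in> I \<Longrightarrow> a * S_fun \<gamma> x + b * C_fun \<gamma> x \<noteq> 0" unfolding psi1_condition_def by blast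
  obtain x where "x \<in> I" using I by auto
  with h[of x] const[of x] show False by (simp add: \<psi>_def)
next
  assume "psi2_condition I F f g"
  then obtain a b \<gamma> l where h: "\<And>x. x \<in> I \<Longrightarrow> \<psi> g 2 x = a * P_fun \<gamma> x + b * Q_fun \<gamma> x + l"
    "\<And>x. x \<in> I \<Longrightarrow> a * S_fun \<gamma> x + b * C_fun \<gamma> x \<noteq> 0" unfolding psi2_condition_def by blast
  define k where "k = (if \<gamma> = 0 then 1 else sqrt \<bar>\<gamma>\<bar>)"
  have k: "k \<noteq> 0" by (simp add: k_def)
  have der: "((\<lambda>x. a * P_fun \<gamma> x + b * Q_fun \<gamma> x + l) has_real_derivative
      k * (a * S_fun \<gamma> x + b * C_fun \<gamma> x)) (at x)" for x
    unfolding P_fun_def Q_fun_def S_fun_def C_fun_def k_def Let_def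
    by (cases "\<gamma> < 0"; cases "\<gamma> = 0") (auto intro!: derivative_eq_intros simp: algebra_simps)
  obtain x where x: "x \<in> I" using I by auto
  have "((\<lambda>x. a * P_fun \<gamma> x + b * Q_fun \<gamma> x + l) has_real_derivative 0) (at x)"
  proof (rule has_field_derivative_transform_within_open[OF _ I(1) x])
    show "((\<lambda>x. 2 * E) has_real_derivative 0) (at x)" by simp
    show "2 * E = a * P_fun \<gamma> z + b * Q_fun \<gamma> z + l" if "z \<in> I" for z
      using h(1)[OF that] const[OF that] by (simp add: \<psi>_def)
  qed
  from DERIV_unique[OF this der] show False using k h(2)[OF x] by simp
qed

text \<open>The derivatives of the functions in a regular solution. The midpoint enters only through
  \<open>cot (s + t)\<close> with \<open>s = \<alpha> * x\<close> and \<open>t = \<alpha> * y + \<delta>\<close>, so that the equation for the derivatives takes the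
  form \<open>cos (s + t) * p\<^sub>1 + sin (s + t) * r\<^sub>1 = cos (s + t) * p\<^sub>2 + sin (s + t) * r\<^sub>2\<close>, where the left
  functions depend on \<open>x\<close> and the right ones on \<open>y\<close>, and the variables separate.\<close>

lemma regular_solution_structure:
  assumes I: "open I" "is_interval I" "I \<noteq> {}" and sol: "regular_solution I F f G g"
    and trig: "trig_condition I F f g"
  obtains A0 B0 M0 E H \<alpha> \<delta> and \<beta> :: "nat \<Rightarrow> real" where
    "A0 \<noteq> 0" "H \<noteq> 0" "\<alpha> > 0" "\<beta> 1 + \<beta> 2 = \<delta>"
    "\<And>x. x \<in> I \<Longrightarrow> sin (2 * \<alpha> * x + \<delta>) \<noteq> 0"
    "\<And>x. x \<in> I \<Longrightarrow> \<phi> F x = B0 + A0 * (cos (2 * \<alpha> * x + \<delta>) / sin (2 * \<alpha> * x + \<delta>))"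
    "\<And>x k. x \<in> I \<Longrightarrow> k \<in> {1, 2} \<Longrightarrow> 1 / deriv (g k) x = E + H * cos (2 * \<alpha> * x + 2 * \<beta> k)"
    "\<And>x k. x \<in> I \<Longrightarrow> k \<in> {1, 2} \<Longrightarrow> deriv (f k) x / deriv (g k) x
        = A0 * (H * sin (2 * \<alpha> * x + 2 * \<beta> k) - M0) - B0 * (E + H * cos (2 * \<alpha> * x + 2 * \<beta> k))"
proof -
  have frac: "trig_fraction_on (\<phi> F) I" and psi: "psi1_condition I F g \<or> psi2_condition I F f g"
    using trig unfolding trig_condition_def by blast+
  obtain A0 B0 \<alpha> \<delta> where A0: "A0 \<noteq> 0" and \<alpha>: "\<alpha> > 0"
    and snz: "\<And>x. x \<in> I \<Longrightarrow> sin (2 * \<alpha> * x + \<delta>) \<noteq> 0"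
    and phi: "\<And>x. x \<in> I \<Longrightarrow> \<phi> F x = B0 + A0 * (cos (2 * \<alpha> * x + \<delta>) / sin (2 * \<alpha> * x + \<delta>))"
    by (rule trig_fraction_cot[OF frac], rule that)
  define p where "p k x = 1 / deriv (g k) x" for k x
  define q where "q k x = deriv (f k) x / deriv (g k) x" for k x
  define r where "r k x = (q k x + B0 * p k x) / A0" for k x
  define s where "s x = \<alpha> * x" for x
  define t where "t y = \<alpha> * y + \<delta>" for y
  have main: "cos (s x + t y) * (p 1 x - p 2 y) = sin (s x + t y) * (r 2 y - r 1 x)"
    if x: "x \<in> I" and y: "y \<in> I" for x y
  proof -
    have m: "(x + y) / 2 \<in> I" by (rule midpoint_in_interval[OF I(2) x y])
    have st: "2 * \<alpha> * ((x + y) / 2) + \<delta> = s x + t y" by (simp add: s_def t_def algebra_simps)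
    have S: "sin (s x + t y) \<noteq> 0" using snz[OF m] unfolding st .
    have "(B0 + A0 * (cos (s x + t y) / sin (s x + t y))) * (p 1 x - p 2 y) = q 2 y - q 1 x"
      using regular_solution_functional_equation[OF I(1,2) sol x y] unfolding phi[OF m] st p_def q_def .
    then have "A0 * (cos (s x + t y) / sin (s x + t y)) * (p 1 x - p 2 y)
        = (q 2 y + B0 * p 2 y) - (q 1 x + B0 * p 1 x)"
      by algebra
    also have "\<dots> = A0 * (r 2 y - r 1 x)" using A0 by (simp add: r_def right_diff_distrib)
    finally have "cos (s x + t y) / sin (s x + t y) * (p 1 x - p 2 y) = r 2 y - r 1 x"
      by (simp only: mult.assoc mult_left_cancel[OF A0])
    then show ?thesis using S by (simp add: field_simps)
  qed
  obtain x0 where x0: "x0 \<in> I" using I(3) by auto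
  obtain e where e: "e > 0" "ball x0 e \<subseteq> I" using I(1) x0 by (auto simp: open_contains_ball)
  \<comment> \<open>The points \<open>x0\<close> and \<open>x0 + d\<close> make sine and cosine linearly independent.\<close>
  define d where "d = min (e / 2) (pi / (2 * \<alpha>))"
  have d: "d > 0" "d < e" using e \<alpha> by (auto simp: d_def min_def)
  have "\<alpha> * d \<le> \<alpha> * (pi / (2 * \<alpha>))" using \<alpha> unfolding d_def by (intro mult_left_mono) auto
  also have "\<alpha> * (pi / (2 * \<alpha>)) = pi / 2" using \<alpha> by simp
  also have "pi / 2 < pi" by simp
  finally have "\<alpha> * d < pi" .
  then have sind: "sin (\<alpha> * d) \<noteq> 0" using sin_gt_zero[of "\<alpha> * d"] \<alpha> d by simp
  have x1: "x0 + d \<in> I" using e d by (intro subsetD[OF e(2)]) (simp add: dist_real_def)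
  have sd: "sin (s (x0 + d) - s x0) \<noteq> 0" "sin (t (x0 + d) - t x0) \<noteq> 0"
    using sind by (simp_all add: s_def t_def algebra_simps)
  define X where "X k \<theta> x = cos \<theta> * p k x + sin \<theta> * r k x" for k \<theta> x
  define Y where "Y k \<theta> x = sin \<theta> * p k x - cos \<theta> * r k x" for k \<theta> x
  have sep: "X 1 (s x) x * cos (t y) - Y 1 (s x) x * sin (t y) = X 2 (t y) y * cos (s x) - Y 2 (t y) y * sin (s x)"
    if "x \<in> I" "y \<in> I" for x y
    using main[OF that] unfolding X_def Y_def sin_add cos_add by algebra
  obtain m11 m12 m21 m22 where
    X1: "\<And>x. x \<in> I \<Longrightarrow> X 1 (s x) x = m11 * cos (s x) - m12 * sin (s x)" and
    Y1: "\<And>x. x \<in> I \<Longrightarrow> Y 1 (s x) x = m21 * cos (s x) - m22 * sin (s x)" and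
    X2: "\<And>y. y \<in> I \<Longrightarrow> X 2 (t y) y = m11 * cos (t y) - m21 * sin (t y)" and
    Y2: "\<And>y. y \<in> I \<Longrightarrow> Y 2 (t y) y = m12 * cos (t y) - m22 * sin (t y)"
    by (rule trig_separation[of I "\<lambda>x. X 1 (s x) x" t "\<lambda>x. Y 1 (s x) x" "\<lambda>y. X 2 (t y) y" s
        "\<lambda>y. Y 2 (t y) y", OF sep x0 x1 sd(1) x0 x1 sd(2)],
        assumption, assumption, rule that)
  define E where "E = (m11 - m22) / 2"
  define M0 where "M0 = (m12 + m21) / 2"
  obtain H \<omega> where K: "(m11 + m22) / 2 = H * cos \<omega>" and L: "(m21 - m12) / 2 = H * sin \<omega>"
    using polar_Ex by blast
  have m: "m11 = H * cos \<omega> + E" "m22 = H * cos \<omega> - E" "m21 = M0 + H * sin \<omega>" "m12 = M0 - H * sin \<omega>"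
    using K L unfolding E_def M0_def by (simp_all add: field_simps)
  \<comment> \<open>Solving for \<open>p\<close> and \<open>rr\<close> by the inverse rotation and collecting the double angles.\<close>
  have dbl: "p = E * (C\<^sup>2 + S\<^sup>2) + H * (c * (C\<^sup>2 - S\<^sup>2) + v * (2 * S * C))"
    "rr = H * (c * (2 * S * C) - v * (C\<^sup>2 - S\<^sup>2)) - M0 * (C\<^sup>2 + S\<^sup>2)"
    if "C * p + S * rr = (H * c + E) * C - (M0 - H * v) * S"
      "S * p - C * rr = (M0 + H * v) * C - (H * c - E) * S" "C\<^sup>2 + S\<^sup>2 = 1"
    for p rr C S c v :: real
    using that by algebra+
  have one: "(cos \<theta>)\<^sup>2 + (sin \<theta>)\<^sup>2 = 1" for \<theta> :: real by simp
  have dc: "(cos \<theta>)\<^sup>2 - (sin \<theta>)\<^sup>2 = cos (2 * \<theta>)" "2 * sin \<theta> * cos \<theta> = sin (2 * \<theta>)" for \<theta> :: real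
    by (simp_all add: cos_double sin_double)
  \<comment> \<open>The phase \<open>\<omega>\<close> enters the two indices with opposite signs and cancels in \<open>\<beta> 1 + \<beta> 2\<close>.\<close>
  define \<beta> where "\<beta> k = (if k = 1 then - \<omega> / 2 else \<delta> + \<omega> / 2)" for k :: nat
  have pr: "p k x = E + H * cos (2 * \<alpha> * x + 2 * \<beta> k) \<and> r k x = H * sin (2 * \<alpha> * x + 2 * \<beta> k) - M0"
    if x: "x \<in> I" and k: "k \<in> {1, 2}" for k x
  proof (cases "k = 1")
    case True
    have ang: "2 * \<alpha> * x + 2 * \<beta> k = 2 * s x - \<omega>" by (simp add: True \<beta>_def s_def)
    note D = dbl[of "cos (s x)" "p 1 x" "sin (s x)" "r 1 x" "cos \<omega>" "sin \<omega>",
        OF X1[OF x, unfolded X_def m] Y1[OF x, unfolded Y_def m] one, unfolded dc one]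
    show ?thesis unfolding ang using D by (simp add: True cos_diff sin_diff algebra_simps)
  next
    case False
    with k have k2: "k = 2" by simp
    have ang: "2 * \<alpha> * x + 2 * \<beta> k = 2 * t x + \<omega>" by (simp add: k2 \<beta>_def t_def algebra_simps)
    have "cos (t x) * p 2 x + sin (t x) * r 2 x = (H * cos \<omega> + E) * cos (t x) - (M0 - H * (- sin \<omega>)) * sin (t x)"
      "sin (t x) * p 2 x - cos (t x) * r 2 x = (M0 + H * (- sin \<omega>)) * cos (t x) - (H * cos \<omega> - E) * sin (t x)"
      using X2[OF x] Y2[OF x] by (simp_all add: X_def Y_def m)
    note D = dbl[OF this one, unfolded dc one]
    show ?thesis unfolding ang using D by (simp add: k2 cos_add sin_add algebra_simps)
  qed
  show thesis
  proof (rule that[of A0 H \<alpha> \<beta> \<delta> B0 E M0])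
    show "\<beta> 1 + \<beta> 2 = \<delta>" by (simp add: \<beta>_def)
    show "1 / deriv (g k) x = E + H * cos (2 * \<alpha> * x + 2 * \<beta> k)" if "x \<in> I" "k \<in> {1, 2}" for x k
      using pr[OF that] by (simp add: p_def)
    show "deriv (f k) x / deriv (g k) x
        = A0 * (H * sin (2 * \<alpha> * x + 2 * \<beta> k) - M0) - B0 * (E + H * cos (2 * \<alpha> * x + 2 * \<beta> k))"
      if "x \<in> I" "k \<in> {1, 2}" for x k
    proof -
      have "q k x = A0 * r k x - B0 * p k x" using A0 by (simp add: r_def)
      then show ?thesis using pr[OF that] by (simp add: q_def)
    qed
    show "H \<noteq> 0"
    proof
      assume "H = 0"
      then have "1 / deriv (g 1) x = E" "1 / deriv (g 2) x = E" if "x \<in> I" for x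
        using pr[OF that, of 1] pr[OF that, of 2] by (simp_all add: p_def)
      from psi_conditions_exclude_constant[OF I(1,3) psi this] show False .
    qed
  qed (use A0 \<alpha> snz phi in auto)
qed

section \<open>Regular solutions belong to the families\<close>

lemma same_derivative_differ_by_constant:
  fixes f h :: "real \<Rightarrow> real"
  assumes "is_interval I" "\<And>x. x \<in> I \<Longrightarrow> (f has_real_derivative f' x) (at x)"
    "\<And>x. x \<in> I \<Longrightarrow> (h has_real_derivative f' x) (at x)"
  obtains c where "\<And>x. x \<in> I \<Longrightarrow> f x = h x + c"
proof -
  have "((\<lambda>x. f x - h x) has_real_derivative 0) (at x within I)" if "x \<in> I" for x
    using DERIV_diff[OF assms(2)[OF that] assms(3)[OF that]] by (simp add: has_field_derivative_at_within)
  then obtain c where "\<forall>x\<in>I. f x - h x = c"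
    using has_field_derivative_zero_constant[of I "\<lambda>x. f x - h x"] assms(1) by (auto simp: is_interval_convex)
  then show thesis by (intro that[of c]) (auto simp: algebra_simps)
qed

text \<open>Integration of the derivatives, for any primitive \<open>h\<close>; the constant term of \<open>1 / g\<^sub>k'\<close> is written \<open>H * T\<close>.\<close>

lemma regular_solution_in_family:
  assumes I: "open I" "is_interval I" and sol: "regular_solution I F f G g"
    and nz: "A0 \<noteq> 0" "H \<noteq> 0" "\<alpha> > 0"
    and snz: "\<And>x. x \<in> I \<Longrightarrow> sin (2 * \<alpha> * x + \<delta>) \<noteq> 0"
    and phi: "\<And>x. x \<in> I \<Longrightarrow> \<phi> F x = B0 + A0 * (cos (2 * \<alpha> * x + \<delta>) / sin (2 * \<alpha> * x + \<delta>))"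
    and p: "\<And>x k. x \<in> I \<Longrightarrow> k \<in> {1, 2} \<Longrightarrow> 1 / deriv (g k) x = H * T + H * cos (2 * \<alpha> * x + 2 * \<beta> k)"
    and q: "\<And>x k. x \<in> I \<Longrightarrow> k \<in> {1, 2} \<Longrightarrow> deriv (f k) x / deriv (g k) x
        = A0 * (H * sin (2 * \<alpha> * x + 2 * \<beta> k) - M0) - B0 * (H * T + H * cos (2 * \<alpha> * x + 2 * \<beta> k))"
    and h: "reciprocal_primitive T h \<rho>"
  obtains A B C D l\<^sub>0 l \<mu> where "A * D \<noteq> 0" "F_form I F A B \<alpha> \<delta> l\<^sub>0"
    "fg_form I h f g A B C D T \<alpha> \<beta> l \<mu>"
proof -
  note der = regular_solution_DERIV[OF sol]
  have \<rho>: "\<rho> \<noteq> 0" using h by (simp add: reciprocal_primitive_def)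
  \<comment> \<open>The constants are those that match the derivatives of the formulas for \<open>g\<close>, \<open>f\<close> and \<open>F\<close>.\<close>
  define D where "D = 1 / (H * \<alpha> * \<rho>)"
  define C where "C = - A0 * M0 * D"
  define A where "A = A0 / (2 * \<alpha>)"
  have AD: "A * D \<noteq> 0" using nz \<rho> by (simp add: A_def D_def)
  have cnz: "cos (2 * \<alpha> * x + 2 * \<beta> k) + T \<noteq> 0" and gd: "deriv (g k) x = 1 / (H * (cos (2 * \<alpha> * x + 2 * \<beta> k) + T))"
    if "x \<in> I" "k \<in> {1, 2}" for x k
  proof -
    have pp: "1 / deriv (g k) x = H * (cos (2 * \<alpha> * x + 2 * \<beta> k) + T)"
      using p[OF that] by (simp add: algebra_simps)
    moreover have "1 / deriv (g k) x \<noteq> 0" using der(4)[OF that] by simp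
    ultimately show "cos (2 * \<alpha> * x + 2 * \<beta> k) + T \<noteq> 0" by auto
    show "deriv (g k) x = 1 / (H * (cos (2 * \<alpha> * x + 2 * \<beta> k) + T))" unfolding pp[symmetric] by simp
  qed
  have "\<exists>m. \<forall>x\<in>I. g k x = D * h (\<alpha> * x + \<beta> k) + m" if k: "k \<in> {1, 2}" for k
  proof -
    have "((\<lambda>x. D * h (\<alpha> * x + \<beta> k) + 0) has_real_derivative deriv (g k) x) (at x)" if "x \<in> I" for x
    proof -
      have "D * (\<alpha> * \<rho> / (cos (2 * \<alpha> * x + 2 * \<beta> k) + T)) = deriv (g k) x"
        using nz \<rho> unfolding gd[OF that k] D_def by simp
      with DERIV_g_formula[OF h cnz[OF that k], of D 0] show ?thesis by (simp only:)
    qed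
    from same_derivative_differ_by_constant[OF I(2) der(3)[OF _ k] this]
    obtain m where "\<And>x. x \<in> I \<Longrightarrow> g k x = D * h (\<alpha> * x + \<beta> k) + 0 + m" by blast
    then show ?thesis by auto
  qed
  then obtain \<mu> where \<mu>: "\<And>k x. k \<in> {1, 2} \<Longrightarrow> x \<in> I \<Longrightarrow> g k x = D * h (\<alpha> * x + \<beta> k) + \<mu> k" by metis
  let ?f = "\<lambda>k x. - A * ln \<bar>cos (2 * \<alpha> * x + 2 * \<beta> k) + T\<bar> - B0 * x + C * h (\<alpha> * x + \<beta> k)"
  have "\<exists>m. \<forall>x\<in>I. f k x = ?f k x + m" if k: "k \<in> {1, 2}" for k
  proof -
    have "((\<lambda>x. ?f k x + 0) has_real_derivative deriv (f k) x) (at x)" if "x \<in> I" for x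
    proof -
      let ?c = "cos (2 * \<alpha> * x + 2 * \<beta> k) + T" and ?s = "sin (2 * \<alpha> * x + 2 * \<beta> k)"
      have "deriv (f k) x = deriv (f k) x / deriv (g k) x * deriv (g k) x" using der(4)[OF that k] by simp
      also have "deriv (f k) x / deriv (g k) x = A0 * (H * ?s - M0) - B0 * (H * ?c)"
        using q[OF that k] by (simp add: algebra_simps)
      also have "(A0 * (H * ?s - M0) - B0 * (H * ?c)) * deriv (g k) x
         = A * (2 * \<alpha> * ?s) / ?c - B0 + C * (\<alpha> * \<rho> / ?c)"
      proof -
        have gen: "(A0 * (H * v - M0) - B0 * (H * c)) * (1 / (H * c)) = A * (2 * \<alpha> * v) / c - B0 + C * (\<alpha> * \<rho> / c)"
          if "c \<noteq> 0" for c v :: real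
          using that nz \<rho> unfolding A_def C_def D_def by (simp add: field_simps)
        show ?thesis unfolding gd[OF \<open>x \<in> I\<close> k] by (rule gen[OF cnz[OF \<open>x \<in> I\<close> k]])
      qed
      finally have "A * (2 * \<alpha> * ?s) / ?c - B0 + C * (\<alpha> * \<rho> / ?c) = deriv (f k) x" by (rule sym)
      with DERIV_f_formula[OF h cnz[OF that k], of A B0 C 0] show ?thesis by (simp only:)
    qed
    from same_derivative_differ_by_constant[OF I(2) der(2)[OF _ k] this]
    obtain m where "\<And>x. x \<in> I \<Longrightarrow> f k x = ?f k x + 0 + m" by blast
    then show ?thesis by auto
  qed
  then obtain l where l: "\<And>k x. k \<in> {1, 2} \<Longrightarrow> x \<in> I \<Longrightarrow> f k x = ?f k x + l k" by metis
  have "((\<lambda>x. 2 * A * ln \<bar>sin (2 * \<alpha> * x + \<delta>)\<bar> + 2 * B0 * x + 0) has_real_derivative deriv F x) (at x)"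
    if "x \<in> I" for x
  proof -
    have "deriv F x = 2 * \<phi> F x" by (simp add: \<phi>_def)
    also have "\<dots> = 2 * A * (2 * \<alpha> * cos (2 * \<alpha> * x + \<delta>)) / sin (2 * \<alpha> * x + \<delta>) + 2 * B0"
      unfolding phi[OF that] A_def using nz by simp
    finally have "2 * A * (2 * \<alpha> * cos (2 * \<alpha> * x + \<delta>)) / sin (2 * \<alpha> * x + \<delta>) + 2 * B0 = deriv F x"
      by (rule sym)
    with DERIV_F_formula[OF snz[OF that], of A B0 0] show ?thesis by (simp only:)
  qed
  from same_derivative_differ_by_constant[OF I(2) der(1) this]
  obtain l\<^sub>0 where "\<And>x. x \<in> I \<Longrightarrow> F x = 2 * A * ln \<bar>sin (2 * \<alpha> * x + \<delta>)\<bar> + 2 * B0 * x + 0 + l\<^sub>0" by blast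
  then have "F_form I F A B0 \<alpha> \<delta> l\<^sub>0" using snz by (simp add: F_form_def)
  moreover have "fg_form I h f g A B0 C D T \<alpha> \<beta> l \<mu>"
    unfolding fg_form_def using cnz l \<mu> by blast
  ultimately show thesis using AD that by blast
qed

lemma G_form_of_solution:
  assumes I: "is_interval I" and sol: "regular_solution I F f G g"
    and F: "F_form I F A B \<alpha> \<beta>\<^sub>0 l\<^sub>0" and fg: "fg_form I h f g A B C D T \<alpha> \<beta> l \<mu>"
    and \<beta>: "\<beta> 1 + \<beta> 2 = of_int n * pi + \<beta>\<^sub>0" and D: "D \<noteq> 0"
    and add: "\<And>x y. x \<in> I \<Longrightarrow> y \<in> I \<Longrightarrow> addition_law T h w D (\<alpha> * x + \<beta> 1) (\<alpha> * y + \<beta> 2)"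
  shows "G_form (g 1 ` I + g 2 ` I) w G A C D (\<mu> 1 + \<mu> 2) (l\<^sub>0 + l 1 + l 2)"
  unfolding G_form_def
proof (rule ballI)
  fix u assume "u \<in> g 1 ` I + g 2 ` I"
  then obtain x y where xy: "x \<in> I" "y \<in> I" and u: "u = g 1 x + g 2 y" by (auto simp: set_plus_def)
  have "F ((x + y) / 2) + f 1 x + f 2 y = G u"
    using sol xy unfolding regular_solution_def solves_E_def u by blast
  with family_satisfies_E[OF F fg \<beta> D add[OF xy] xy midpoint_in_interval[OF I xy]]
  show "w (u - (\<mu> 1 + \<mu> 2)) \<noteq> 0 \<and>
      G u = 2 * A * ln \<bar>w (u - (\<mu> 1 + \<mu> 2))\<bar> + C * ((u - (\<mu> 1 + \<mu> 2)) / D) + (l\<^sub>0 + l 1 + l 2)"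
    unfolding u by (simp only: simp_thms)
qed

lemma regular_solution_is_solution_family:
  assumes I: "open I" "is_interval I" "I \<noteq> {}" and sol: "regular_solution I F f G g"
    and trig: "trig_condition I F f g"
  shows "\<exists>A B C D T \<alpha> \<beta>\<^sub>0 \<beta> l\<^sub>0 l \<mu>. solution_family I F f G g A B C D T \<alpha> \<beta>\<^sub>0 \<beta> l\<^sub>0 l \<mu>"
proof -
  obtain A0 B0 M0 E H \<alpha> \<delta> and \<beta> :: "nat \<Rightarrow> real" where
    nz: "A0 \<noteq> 0" "H \<noteq> 0" "\<alpha> > 0" and \<beta>: "\<beta> 1 + \<beta> 2 = \<delta>"
    and snz: "\<And>x. x \<in> I \<Longrightarrow> sin (2 * \<alpha> * x + \<delta>) \<noteq> 0"
    and phi: "\<And>x. x \<in> I \<Longrightarrow> \<phi> F x = B0 + A0 * (cos (2 * \<alpha> * x + \<delta>) / sin (2 * \<alpha> * x + \<delta>))"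
    and p: "\<And>x k. x \<in> I \<Longrightarrow> k \<in> {1, 2} \<Longrightarrow> 1 / deriv (g k) x = E + H * cos (2 * \<alpha> * x + 2 * \<beta> k)"
    and q: "\<And>x k. x \<in> I \<Longrightarrow> k \<in> {1, 2} \<Longrightarrow> deriv (f k) x / deriv (g k) x
        = A0 * (H * sin (2 * \<alpha> * x + 2 * \<beta> k) - M0) - B0 * (E + H * cos (2 * \<alpha> * x + 2 * \<beta> k))"
    by (rule regular_solution_structure[OF I sol trig], rule that)
  define T where "T = E / H"
  have E: "E = H * T" using nz by (simp add: T_def)
  have forms: "\<exists>A B C D l\<^sub>0 l \<mu>. A * D \<noteq> 0 \<and> F_form I F A B \<alpha> \<delta> l\<^sub>0 \<and> fg_form I h f g A B C D T \<alpha> \<beta> l \<mu>"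
    if "reciprocal_primitive T h \<rho>" for h \<rho>
    by (rule regular_solution_in_family[OF I(1,2) sol nz snz phi p[unfolded E] q[unfolded E] that]) blast+
  have \<beta>': "\<beta> 1 + \<beta> 2 = of_int 0 * pi + \<delta>" using \<beta> by simp
  have \<alpha>: "\<alpha> \<noteq> 0" using nz by simp
  note G = G_form_of_solution[OF I(2) sol _ _ \<beta>']
  consider "T\<^sup>2 = 1" | "T\<^sup>2 > 1" | "T\<^sup>2 < 1" by linarith
  then show ?thesis
  proof cases
    case 1
    obtain A B C D l\<^sub>0 l \<mu> where AD: "A * D \<noteq> 0" and F: "F_form I F A B \<alpha> \<delta> l\<^sub>0"
      and fg: "fg_form I (tan_pow T) f g A B C D T \<alpha> \<beta> l \<mu>"
      using forms[OF tan_pow_primitive[OF 1]] by blast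
    have D: "D \<noteq> 0" using AD by auto
    have "G_form (g 1 ` I + g 2 ` I) (\<lambda>v. v / (2 * D)) G A C D (\<mu> 1 + \<mu> 2) (l\<^sub>0 + l 1 + l 2)"
      by (rule G[OF F fg D addition_law_tan_pow[OF 1 _ _ D]]) (rule fg_form_nonzero[OF fg]; simp)+
    then have "T2 I f G g A B C D T \<alpha> \<beta> l\<^sub>0 l \<mu>" using 1 fg by (simp only: T2_def simp_thms)
    then show ?thesis using AD \<alpha> \<beta>' F unfolding solution_family_def by blast
  next
    case 2
    obtain A B C D l\<^sub>0 l \<mu> where AD: "A * D \<noteq> 0" and F: "F_form I F A B \<alpha> \<delta> l\<^sub>0"
      and fg: "fg_form I (arctan_tan (tau T)) f g A B C D T \<alpha> \<beta> l \<mu>"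
      using forms[OF arctan_tan_primitive[OF 2]] by blast
    have D: "D \<noteq> 0" using AD by auto
    have "G_form (g 1 ` I + g 2 ` I) (\<lambda>v. T_star T * sin (v / D)) G A C D (\<mu> 1 + \<mu> 2) (l\<^sub>0 + l 1 + l 2)"
      by (rule G[OF F fg D addition_law_arctan_tan[OF 2 _ _ D]]) (rule fg_form_nonzero[OF fg]; simp)+
    then have "T3 I f G g A B C D T \<alpha> \<beta> l\<^sub>0 l \<mu>" using 2 fg by (simp only: T3_def simp_thms)
    then show ?thesis using AD \<alpha> \<beta>' F unfolding solution_family_def by blast
  next
    case 3
    obtain A B C D l\<^sub>0 l \<mu> where AD: "A * D \<noteq> 0" and F: "F_form I F A B \<alpha> \<delta> l\<^sub>0"
      and fg: "fg_form I (ln_tan (tau T)) f g A B C D T \<alpha> \<beta> l \<mu>"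
      using forms[OF ln_tan_primitive[OF 3]] by blast
    have D: "D \<noteq> 0" using AD by auto
    let ?c = "\<lambda>k x. cos (2 * \<alpha> * x + 2 * \<beta> k) + T"
    have e: "2 * (\<alpha> * x + \<beta> k) = 2 * \<alpha> * x + 2 * \<beta> k" for x k by (simp add: algebra_simps)
    have same: "?c k x * ?c k y > 0" if "k \<in> {1, 2}" "x \<in> I" "y \<in> I" for k x y
      using fg_form_same_sign[OF I(2) fg that] .
    \<comment> \<open>Neither factor changes sign on the interval; a single point decides between \<open>sinh\<close> and \<open>cosh\<close>.\<close>
    obtain x0 where x0: "x0 \<in> I" using I(3) by auto
    have c0: "?c 1 x0 \<noteq> 0" "?c 2 x0 \<noteq> 0"
      using same[of 1, OF _ x0 x0] same[of 2, OF _ x0 x0] by auto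
    show ?thesis
    proof (cases "?c 1 x0 * ?c 2 x0 > 0")
      case True
      have pos: "?c 1 x * ?c 2 y > 0" if "x \<in> I" "y \<in> I" for x y
        using True same[of 1, OF _ x0 that(1)] same[of 2, OF _ x0 that(2)]
        by (auto simp: zero_less_mult_iff)
      have "G_form (g 1 ` I + g 2 ` I) (\<lambda>v. T_star T * sinh (v / (2 * D))) G A C D (\<mu> 1 + \<mu> 2) (l\<^sub>0 + l 1 + l 2)"
        by (rule G[OF F fg D addition_law_sinh[OF 3 _ D]]) (unfold e, rule pos)
      then have "T1_sinh I f G g A B C D T \<alpha> \<beta> l\<^sub>0 l \<mu>" using 3 fg pos unfolding T1_sinh_def by blast
      then show ?thesis using AD \<alpha> \<beta>' F unfolding solution_family_def by blast
    next
      case False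
      have neg: "?c 1 x * ?c 2 y < 0" if "x \<in> I" "y \<in> I" for x y
        using False c0 same[of 1, OF _ x0 that(1)] same[of 2, OF _ x0 that(2)]
        by (auto simp: zero_less_mult_iff mult_less_0_iff not_less order_le_less)
      have "G_form (g 1 ` I + g 2 ` I) (\<lambda>v. T_star T * cosh (v / (2 * D))) G A C D (\<mu> 1 + \<mu> 2) (l\<^sub>0 + l 1 + l 2)"
        by (rule G[OF F fg D addition_law_cosh[OF 3 _ D]]) (unfold e, rule neg)
      then have "T1_cosh I f G g A B C D T \<alpha> \<beta> l\<^sub>0 l \<mu>" using 3 fg neg unfolding T1_cosh_def by blast
      then show ?thesis using AD \<alpha> \<beta>' F unfolding solution_family_def by blast
    qed
  qed
qed

theorem theorem16:
  fixes I :: "real set"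
  assumes "open I" and "is_interval I" and "I \<noteq> {}"
  shows
    "(\<forall>F f G g.
        regular_solution I F f G g \<and> trig_condition I F f g \<longrightarrow>
        (\<exists>A B C D T \<alpha> \<beta>\<^sub>0 \<beta> l\<^sub>0 l \<mu>.
           solution_family I F f G g A B C D T \<alpha> \<beta>\<^sub>0 \<beta> l\<^sub>0 l \<mu>)) \<and>
     (\<forall>F f G g A B C D T \<alpha> \<beta>\<^sub>0 \<beta> l\<^sub>0 l \<mu>.
        solution_family I F f G g A B C D T \<alpha> \<beta>\<^sub>0 \<beta> l\<^sub>0 l \<mu> \<longrightarrow>
        regular_solution I F f G g)"
proof (intro conjI allI impI)
  fix F f G g
  assume "regular_solution I F f G g \<and> trig_condition I F f g"
  then show "\<exists>A B C D T \<alpha> \<beta>\<^sub>0 \<beta> l\<^sub>0 l \<mu>. solution_family I F f G g A B C D T \<alpha> \<beta>\<^sub>0 \<beta> l\<^sub>0 l \<mu>"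
    using regular_solution_is_solution_family[OF assms] by blast
next
  fix F f G g A B C D T \<alpha> \<beta>\<^sub>0 \<beta> l\<^sub>0 l \<mu>
  assume "solution_family I F f G g A B C D T \<alpha> \<beta>\<^sub>0 \<beta> l\<^sub>0 l \<mu>"
  then show "regular_solution I F f G g"
    by (rule solution_family_is_regular_solution[OF assms(1,2)])
qed

end
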